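(* For $d=7$ there are a permutation $\sigma$ of $d$ symbols, a uniquely ergodic self-similar interval exchange transformation $\mathcal{IE}_0$ on $d$ intervals, and a line segment $\ell\subset\mathbb R^d_+$, such that $\mathcal{IE}_0=\mathcal{IE}_\sigma(\mathbf a_0)$ with $\mathbf a_0$ in the interior of $\ell$, and such that for all $\mathbf a\in\ell\setminus\{\mathbf a_0\}$ the interval exchange $\mathcal{IE}_\sigma(\mathbf a)$ is periodic.
   Context: $\mathbb R^d_+$ is the set of vectors in $\mathbb R^d$ with all entries positive. For a permutation $\sigma$ on $d$ symbols and $\mathbf a=(a_1,\dots,a_d)\in\mathbb R^d_+$, $\mathcal{IE}_\sigma(\mathbf a):I\to I$ is the interval exchange transformation obtained by partitioning $I=[0,\sum a_i)$ into consecutive half-open subintervals of lengths $a_1,\dots,a_d$ and permuting them by translations according to $\sigma$. It is uniquely ergodic if Lebesgue measure is, up to scaling, its only invariant measure; periodic if every orbit is periodic; self-similar if there is a proper subinterval $J\subsetneq I$ such that the first return map to $J$ is, up to rescaling $J$ to $I$, the transformation itself. *)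

theory Defs
  imports "HOL-Analysis.Analysis"
begin

definition positive_vectors :: "(real ^ 'n) set" where
  "positive_vectors = {a. \<forall>i. 0 < a $ i}"

text \<open>
  The \<open>d\<close> symbols are the elements of a finite linearly ordered type \<^typ>\<open>'n\<close> with
  \<open>CARD('n) = d\<close>; the order is the left-to-right order of the subintervals before the exchange.
\<close>

definition ie_domain :: "real ^ 'n \<Rightarrow> real set" where
  "ie_domain a = {0..<(\<Sum>i\<in>UNIV. a $ i)}"

definition ie_subinterval :: "real ^ 'n::{finite,linorder} \<Rightarrow> 'n \<Rightarrow> real set" where
  "ie_subinterval a i = {(\<Sum>j | j < i. a $ j)..<(\<Sum>j | j \<le> i. a $ j)}"

text \<open>
  Convention: \<open>\<sigma> i\<close> is the position, after the exchange, of the subinterval that was at position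
  \<open>i\<close>, so the \<open>i\<close>-th subinterval is translated to the one with left endpoint
  \<open>\<Sum>j | \<sigma> j < \<sigma> i. a $ j\<close>.  Outside \<open>ie_domain a\<close> the value is irrelevant and set to \<open>x\<close>.
\<close>

definition interval_exchange ::
    "('n \<Rightarrow> 'n) \<Rightarrow> real ^ 'n::{finite,linorder} \<Rightarrow> real \<Rightarrow> real" where
  "interval_exchange \<sigma> a x =
     (if x \<in> ie_domain a then
        (let i = (THE i. x \<in> ie_subinterval a i)
         in x - (\<Sum>j | j < i. a $ j) + (\<Sum>j | \<sigma> j < \<sigma> i. a $ j))
      else x)"

definition invariant_measure :: "(real \<Rightarrow> real) \<Rightarrow> real measure \<Rightarrow> bool" where
  "invariant_measure T M \<longleftrightarrow> T \<in> M \<rightarrow>\<^sub>M M \<and> distr M M T = M"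

text \<open>
  Invariant measures are understood to be finite Borel measures on \<open>I\<close>; without finiteness,
  the counting measure on an infinite orbit would always be a second invariant measure.
\<close>

definition uniquely_ergodic_on :: "real set \<Rightarrow> (real \<Rightarrow> real) \<Rightarrow> bool" where
  "uniquely_ergodic_on I T \<longleftrightarrow>
     invariant_measure T (restrict_space lborel I) \<and>
     (\<forall>M. sets M = sets (restrict_space borel I) \<and> finite_measure M \<and> invariant_measure T M \<longrightarrow>
        (\<exists>c. M = scale_measure c (restrict_space lborel I)))"

definition periodic_on :: "real set \<Rightarrow> (real \<Rightarrow> real) \<Rightarrow> bool" where
  "periodic_on I T \<longleftrightarrow> (\<forall>x\<in>I. \<exists>n>0. (T ^^ n) x = x)"

definition first_return :: "(real \<Rightarrow> real) \<Rightarrow> real set \<Rightarrow> real \<Rightarrow> real" where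
  "first_return T J x = (T ^^ (LEAST n. 0 < n \<and> (T ^^ n) x \<in> J)) x"

text \<open>The map \<open>x \<mapsto> c * x + b\<close> below is the rescaling of \<open>J\<close> to \<open>I\<close>.\<close>

definition self_similar_on :: "real set \<Rightarrow> (real \<Rightarrow> real) \<Rightarrow> bool" where
  "self_similar_on I T \<longleftrightarrow>
     (\<exists>J. is_interval J \<and> J \<subset> I \<and>
        (\<forall>x\<in>J. \<exists>n>0. (T ^^ n) x \<in> J) \<and>
        (\<exists>c b. 0 < c \<and> (\<lambda>x. c * x + b) ` J = I \<and>
           (\<forall>x\<in>J. c * first_return T J x + b = T (c * x + b))))"

end

theory Submission
  imports Defs
begin

text \<open>
  Let \<open>\<alpha> + \<alpha>\<^sup>2 + \<alpha>\<^sup>3 = 1\<close>, cut a circle of length \<open>1\<close> into arcs of lengths \<open>\<alpha>\<close>, \<open>\<alpha>\<^sup>2\<close>, \<open>\<alpha>\<^sup>3\<close>,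
  exchange the two halves of each arc and rotate by \<open>1/2\<close>: this is the Arnoux--Yoccoz map.
  Moving the three midpoints by \<open>t\<close> without changing any of the translations gives a map \<open>T\<^sub>t\<close>; cut
  open at the third midpoint it exchanges seven intervals, whose lengths are affine in \<open>t\<close>.
  The first return of \<open>T\<^sub>t\<close>, \<open>t = \<alpha>\<^sup>2 s\<close>, to a certain interval of length \<open>\<alpha>\<^sup>2\<close> is a scaled copy of \<open>T\<^sub>s\<close>,
  with the same seven itineraries for all \<open>0 \<le> s < \<alpha>\<^sup>3/2\<close>. For \<open>s = 0\<close> this is self-similarity; since
  the itineraries are primitive, averages over the towers of the iterated renormalization become
  constant, which forces unique ergodicity. For \<open>t > 0\<close> the renormalization multiplies \<open>t\<close> by
  \<open>\<alpha>\<^sup>-\<^sup>2\<close> until it lies in \<open>[\<alpha>\<^sup>5/2, \<alpha>\<^sup>3/2)\<close>, where all orbits close up along explicit itineraries.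
  For \<open>t < 0\<close>, \<open>T\<^sub>t\<close> is conjugate to the inverse of \<open>T\<^bsub>-t\<^esub>\<close>.
\<close>

section \<open>Birkhoff sums and return times\<close>

text \<open>Values in a commutative monoid cover both real observables and natural-number return
  times.\<close>

definition birkhoff_sum :: "('a \<Rightarrow> 'a) \<Rightarrow> ('a \<Rightarrow> 'b::comm_monoid_add) \<Rightarrow> nat \<Rightarrow> 'a \<Rightarrow> 'b" where
  "birkhoff_sum T f n x = (\<Sum>k<n. f ((T ^^ k) x))"

lemma birkhoff_sum_0 [simp]: "birkhoff_sum T f 0 x = 0"
  by (simp add: birkhoff_sum_def)

lemma birkhoff_sum_Suc: "birkhoff_sum T f (Suc n) x = birkhoff_sum T f n x + f ((T ^^ n) x)"
  by (simp add: birkhoff_sum_def)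

lemma birkhoff_sum_add:
  "birkhoff_sum T f (m + n) x = birkhoff_sum T f m x + birkhoff_sum T f n ((T ^^ m) x)"
  by (induction n) (simp_all add: birkhoff_sum_Suc add.assoc funpow_add add.commute[of m])

lemma abs_birkhoff_sum_le:
  fixes f :: "'a \<Rightarrow> real"
  assumes "\<And>k. k < n \<Longrightarrow> \<bar>f ((T ^^ k) x)\<bar> \<le> K"
  shows "\<bar>birkhoff_sum T f n x\<bar> \<le> n * K"
  unfolding birkhoff_sum_def
  using sum_bounded_above[of "{..<n}" "\<lambda>k. \<bar>f ((T ^^ k) x)\<bar>" K] assms
  by (auto intro: order_trans[OF sum_abs])

lemma funpow_in: "(\<And>x. x \<in> S \<Longrightarrow> f x \<in> S) \<Longrightarrow> x \<in> S \<Longrightarrow> (f ^^ n) x \<in> S"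
  by (induction n) auto

text \<open>The time taken by \<open>n\<close> returns is itself a Birkhoff sum, of \<open>h\<close>
  along \<open>T'\<close>. The return map \<open>T'\<close> may differ from \<open>T\<close>,
  because renormalization changes the parameter.\<close>

lemma funpow_return:
  assumes "\<And>y. y \<in> S \<Longrightarrow> T' y \<in> S" "\<And>y. y \<in> S \<Longrightarrow> (T ^^ h y) (\<phi> y) = \<phi> (T' y)" "x \<in> S"
  shows "(T ^^ birkhoff_sum T' h n x) (\<phi> x) = \<phi> ((T' ^^ n) x)"
proof (induction n)
  case (Suc n)
  have "(T' ^^ n) x \<in> S" using funpow_in[of S T'] assms by blast
  with Suc assms(2) show ?case
    by (simp add: birkhoff_sum_Suc add.commute[of "birkhoff_sum T' h n x"] funpow_add)
qed simp

text \<open>By invariance the integral of the \<open>n\<close>-th Birkhoff sum is \<open>n\<close>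
  times that of \<open>f\<close>; a lower bound uniform in \<open>n\<close> rules out a negative
  integral.\<close>

lemma integral_nonneg_if_birkhoff_bounded_below:
  fixes f :: "real \<Rightarrow> real"
  assumes fin: "finite_measure M" and inv: "invariant_measure T M"
    and f: "integrable M f"
    and low: "\<And>x n. x \<in> space M \<Longrightarrow> - C \<le> birkhoff_sum T f n x"
  shows "0 \<le> integral\<^sup>L M f"
proof (rule ccontr)
  interpret finite_measure M by fact
  have T: "T \<in> M \<rightarrow>\<^sub>M M" and d: "distr M M T = M"
    using inv by (auto simp: invariant_measure_def)
  have Tn: "(T ^^ k) \<in> M \<rightarrow>\<^sub>M M" for k
  proof (induction k)
    case (Suc k)
    then show ?case using measurable_compose[OF Suc T] by (simp add: o_def)
  qed simp
  have dn: "distr M M (T ^^ k) = M" for k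
  proof (induction k)
    case (Suc k)
    have "distr M M (T \<circ> T ^^ k) = distr (distr M M (T ^^ k)) M T"
      using Tn T by (simp add: distr_distr)
    then show ?case using Suc d by (simp only: funpow.simps)
  qed (simp add: distr_id2)
  have int: "integrable M (\<lambda>x. f ((T ^^ k) x))" "(\<integral>x. f ((T ^^ k) x) \<partial>M) = integral\<^sup>L M f" for k
    using integrable_distr_eq[OF Tn, of f k] integral_distr[OF Tn, of f k] f dn[of k]
    by auto
  assume neg: "\<not> 0 \<le> integral\<^sup>L M f"
  have *: "- C * measure M (space M) \<le> n * integral\<^sup>L M f" for n :: nat
  proof -
    have "(\<integral>x. - C \<partial>M) \<le> (\<integral>x. birkhoff_sum T f n x \<partial>M)"
      by (rule integral_mono) (use low int in \<open>auto simp: birkhoff_sum_def\<close>)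
    also have "\<dots> = n * integral\<^sup>L M f"
      unfolding birkhoff_sum_def by (subst Bochner_Integration.integral_sum) (use int in auto)
    finally show ?thesis by (simp add: mult.commute)
  qed
  obtain n :: nat where "C * measure M (space M) < n * (- integral\<^sup>L M f)"
    using reals_Archimedean3[of "- integral\<^sup>L M f"] neg by auto
  with *[of n] show False by simp
qed

lemma inj_on_funpow:
  assumes "inj_on T S" "\<And>x. x \<in> S \<Longrightarrow> T x \<in> S"
  shows "inj_on (T ^^ n) S"
proof (induction n)
  case (Suc n)
  have "(T ^^ n) ` S \<subseteq> S" using funpow_in[of S T] assms(2) by blast
  then show ?case using comp_inj_on[OF Suc inj_on_subset[OF assms(1)]] by (simp only: funpow.simps)
qed simp

text \<open>A point whose orbit runs into a periodic orbit is itself periodic: injectivity of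
  \<open>T ^^ k\<close> on \<open>S\<close> cancels the first \<open>k\<close> steps.\<close>

lemma periodic_on_if_hits:
  assumes inj: "inj_on T S" and closed: "\<And>x. x \<in> S \<Longrightarrow> T x \<in> S"
    and hits: "\<And>x. x \<in> S \<Longrightarrow> \<exists>k. (T ^^ k) x \<in> J"
    and per: "\<And>y. y \<in> J \<Longrightarrow> \<exists>n>0. (T ^^ n) y = y"
  shows "periodic_on S T"
  unfolding periodic_on_def
proof
  fix x assume x: "x \<in> S"
  obtain k where "(T ^^ k) x \<in> J" using hits[OF x] by blast
  then obtain n where n: "n > 0" "(T ^^ n) ((T ^^ k) x) = (T ^^ k) x" using per by blast
  have "(T ^^ k) ((T ^^ n) x) = (T ^^ k) x"
    using n(2) by (metis add.commute comp_apply funpow_add)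
  moreover have "(T ^^ n) x \<in> S" using funpow_in[of S T] closed x by blast
  ultimately show "\<exists>n>0. (T ^^ n) x = x"
    using inj_onD[OF inj_on_funpow[OF inj closed]] x n(1) by blast
qed

text \<open>The relation \<open>T (f (T' x)) = f x\<close> says, without mentioning inverses, that
  \<open>f\<close> turns steps of \<open>T'\<close> into backward steps of \<open>T\<close>. It
  iterates, and injectivity of \<open>T ^^ n\<close> then closes the orbit.\<close>

lemma periodic_on_reversal:
  assumes inj: "inj_on T S" and closed: "\<And>x. x \<in> S \<Longrightarrow> T x \<in> S" and per: "periodic_on S T"
    and inj': "inj_on f S" and f_in: "\<And>x. x \<in> S \<Longrightarrow> f x \<in> S" and closed': "\<And>x. x \<in> S \<Longrightarrow> T' x \<in> S"
    and rev: "\<And>x. x \<in> S \<Longrightarrow> T (f (T' x)) = f x"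
  shows "periodic_on S T'"
  unfolding periodic_on_def
proof
  fix x assume x: "x \<in> S"
  have in': "(T' ^^ n) x \<in> S" for n using funpow_in[of S T'] closed' x by blast
  have rev_pow: "(T ^^ n) (f ((T' ^^ n) x)) = f x" for n
  proof (induction n)
    case (Suc n)
    then show ?case using rev[OF in'[of n]] by (simp add: funpow_swap1)
  qed simp
  obtain n where n: "n > 0" "(T ^^ n) (f x) = f x" using per f_in[OF x] unfolding periodic_on_def by blast
  have "f ((T' ^^ n) x) = f x"
    using inj_onD[OF inj_on_funpow[OF inj closed, of n]] rev_pow[of n] n(2) f_in in' x by metis
  then have "(T' ^^ n) x = x" using inj_onD[OF inj'] in' x by blast
  with n(1) show "\<exists>n>0. (T' ^^ n) x = x" by blast
qed


section \<open>Unique ergodicity of self-induced maps\<close>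

text \<open>Positivity of the entry for \<open>x\<close> and \<open>i\<close> in the
  \<open>j\<close>-th power of the incidence matrix of the towers: unfolding the tower over
  \<open>x\<close> through \<open>j\<close> levels meets the cell \<open>i\<close>.\<close>

primrec reaches :: "(real \<Rightarrow> real) \<Rightarrow> (real \<Rightarrow> real) \<Rightarrow> (real \<Rightarrow> nat) \<Rightarrow> (real \<Rightarrow> nat) \<Rightarrow> nat \<Rightarrow> nat \<Rightarrow> real \<Rightarrow> bool" where
  "reaches T \<phi> h cell 0 i x \<longleftrightarrow> cell x = i"
| "reaches T \<phi> h cell (Suc j) i x \<longleftrightarrow> (\<exists>k<h x. reaches T \<phi> h cell j i ((T ^^ k) (\<phi> x)))"

text \<open>
  The map \<open>\<phi>\<close> embeds \<open>I\<close> as a scaled copy; \<open>h\<close> is the return time to it, and the orbit up to the return only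
  depends on the cell. The eigenfunction \<open>v\<close> makes the heights of all towers of a level comparable.
\<close>

locale self_induced =
  fixes T \<phi> :: "real \<Rightarrow> real" and h cell :: "real \<Rightarrow> nat" and \<rho> V :: real and v :: "real \<Rightarrow> real" and b m hmax :: nat
    and I :: "real set"
  assumes I_def: "I = {0..<1}"
    and T_in: "x \<in> I \<Longrightarrow> T x \<in> I"
    and \<phi>_in: "x \<in> I \<Longrightarrow> \<phi> x \<in> I"
    and contraction: "0 < \<rho>" "\<rho> < 1"
    and h_pos: "x \<in> I \<Longrightarrow> 0 < h x"
    and h_le: "x \<in> I \<Longrightarrow> h x \<le> hmax"
    and return_\<phi>: "x \<in> I \<Longrightarrow> (T ^^ h x) (\<phi> x) = \<phi> (T x)"
    and h_cell: "x \<in> I \<Longrightarrow> y \<in> I \<Longrightarrow> cell x = cell y \<Longrightarrow> h x = h y"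
    and cell_orbit: "x \<in> I \<Longrightarrow> y \<in> I \<Longrightarrow> cell x = cell y \<Longrightarrow> k < h x \<Longrightarrow>
          cell ((T ^^ k) (\<phi> x)) = cell ((T ^^ k) (\<phi> y))"
    and dist_orbit: "x \<in> I \<Longrightarrow> y \<in> I \<Longrightarrow> cell x = cell y \<Longrightarrow> k < h x \<Longrightarrow>
          \<bar>(T ^^ k) (\<phi> x) - (T ^^ k) (\<phi> y)\<bar> = \<rho> * \<bar>x - y\<bar>"
    and hits: "x \<in> I \<Longrightarrow> \<exists>k\<le>b. \<exists>y\<in>I. (T ^^ k) x = \<phi> y"
    and v_bounds: "x \<in> I \<Longrightarrow> 1 \<le> v x" "x \<in> I \<Longrightarrow> v x \<le> V"
    and v_eigen: "x \<in> I \<Longrightarrow> birkhoff_sum T v (h x) (\<phi> x) = v x / \<rho>"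
    and primitive: "x \<in> I \<Longrightarrow> y \<in> I \<Longrightarrow> reaches T \<phi> h cell m (cell y) x"
begin

section \<open>Sums over towers and tower heights\<close>

lemma orbit_in: "x \<in> I \<Longrightarrow> (T ^^ k) x \<in> I"
  using funpow_in[of I T] T_in by blast

text \<open>These are special Birkhoff sums: \<open>(ren ^^ n) f x\<close> is the sum of
  \<open>f\<close> over all floors of the tower of level \<open>n\<close> over \<open>x\<close>, so
  that \<open>height n\<close> below counts floors.\<close>

definition ren :: "(real \<Rightarrow> real) \<Rightarrow> real \<Rightarrow> real" where
  "ren f x = birkhoff_sum T f (h x) (\<phi> x)"

lemma ren_pow_Suc: "(ren ^^ Suc n) f x = (\<Sum>k<h x. (ren ^^ n) f ((T ^^ k) (\<phi> x)))"
  by (simp add: ren_def[of "(ren ^^ n) f"] birkhoff_sum_def)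

definition height :: "nat \<Rightarrow> real \<Rightarrow> real" where
  "height n = (ren ^^ n) (\<lambda>_. 1)"

lemma ren_mono:
  assumes "\<And>x. x \<in> I \<Longrightarrow> f x \<le> g x" "x \<in> I"
  shows "ren f x \<le> ren g x"
  unfolding ren_def birkhoff_sum_def using assms orbit_in \<phi>_in by (intro sum_mono) auto

lemma ren_pow_mono:
  assumes "\<And>x. x \<in> I \<Longrightarrow> f x \<le> g x" "x \<in> I"
  shows "(ren ^^ n) f x \<le> (ren ^^ n) g x"
  using assms(2) by (induction n arbitrary: x) (auto intro: assms(1) ren_mono)

lemma ren_linear: "ren (\<lambda>x. a * f x + c * g x) x = a * ren f x + c * ren g x"
  by (simp add: ren_def birkhoff_sum_def sum.distrib sum_distrib_left)

lemma ren_pow_linear: "(ren ^^ n) (\<lambda>x. a * f x + c * g x) x = a * (ren ^^ n) f x + c * (ren ^^ n) g x"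
proof (induction n arbitrary: x)
  case (Suc n)
  have "(ren ^^ n) (\<lambda>x. a * f x + c * g x) = (\<lambda>x. a * (ren ^^ n) f x + c * (ren ^^ n) g x)"
    using Suc by blast
  then show ?case by (simp add: ren_linear)
qed simp

lemma ren_pow_eigen: "x \<in> I \<Longrightarrow> (ren ^^ n) v x = v x / \<rho> ^ n"
proof (induction n arbitrary: x)
  case (Suc n)
  have "(ren ^^ Suc n) v x = (\<Sum>k<h x. v ((T ^^ k) (\<phi> x)) / \<rho> ^ n)"
    unfolding ren_pow_Suc using Suc \<phi>_in orbit_in by (intro sum.cong) auto
  also have "\<dots> = v x / \<rho> / \<rho> ^ n"
    using v_eigen[OF Suc.prems] by (simp add: birkhoff_sum_def flip: sum_divide_distrib)
  finally show ?case by (simp add: field_simps)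
qed simp

lemma height_0 [simp]: "height 0 x = 1"
  by (simp add: height_def)

lemma height_Suc: "height (Suc n) x = (\<Sum>k<h x. height n ((T ^^ k) (\<phi> x)))"
  unfolding height_def by (rule ren_pow_Suc)

lemma height_pos: "x \<in> I \<Longrightarrow> 0 < height n x"
proof (induction n arbitrary: x)
  case (Suc n)
  then show ?case unfolding height_Suc using orbit_in \<phi>_in h_pos by (intro sum_pos) (auto simp: lessThan_empty_iff)
qed simp

text \<open>Since \<open>1 \<le> v \<le> V\<close>, sums of \<open>1\<close> and of \<open>v\<close>
  over a tower differ at most by the factor \<open>V\<close>, and the latter are exactly
  \<open>v x / \<rho> ^ n\<close>.\<close>

lemma height_comparable:
  assumes "x \<in> I" "y \<in> I"
  shows "height n x \<le> V\<^sup>2 * height n y"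
proof -
  have V: "1 \<le> V" using v_bounds[OF assms(1)] by simp
  have "height n x \<le> (ren ^^ n) v x"
    unfolding height_def by (rule ren_pow_mono) (use v_bounds assms in auto)
  also have "\<dots> \<le> V / \<rho> ^ n"
    using ren_pow_eigen[OF assms(1)] v_bounds[OF assms(1)] contraction by (simp add: divide_right_mono)
  finally have 1: "height n x \<le> V / \<rho> ^ n" .
  have "1 / \<rho> ^ n \<le> (ren ^^ n) v y"
    using ren_pow_eigen[OF assms(2)] v_bounds[OF assms(2)] contraction by (simp add: divide_right_mono)
  \<comment> \<open>The constant \<open>V\<close> is written as a linear combination so that
    \<open>ren_pow_linear\<close> pulls it out.\<close>
  also have "\<dots> \<le> (ren ^^ n) (\<lambda>x. V * 1 + 0 * 1) y"
    by (rule ren_pow_mono) (use v_bounds assms in auto)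
  also have "\<dots> = V * height n y"
    unfolding ren_pow_linear height_def by simp
  finally have "V * (1 / \<rho> ^ n) \<le> V * (V * height n y)"
    using V by (intro mult_left_mono) auto
  with 1 show ?thesis by (simp add: power2_eq_square algebra_simps)
qed

lemma height_Suc_le:
  assumes "x \<in> I" "y \<in> I"
  shows "height (Suc n) x \<le> hmax * V\<^sup>2 * height n y"
proof -
  have "height (Suc n) x \<le> (\<Sum>k<h x. V\<^sup>2 * height n y)"
    unfolding height_Suc using assms orbit_in \<phi>_in by (intro sum_mono height_comparable) auto
  also have "\<dots> \<le> hmax * (V\<^sup>2 * height n y)"
    using h_le[OF assms(1)] height_pos[OF assms(2), of n] by (simp add: mult_right_mono)
  finally show ?thesis by simp
qed

section \<open>Lower bounds for Birkhoff sums of arbitrary length\<close>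

lemma orbit_from_\<phi>:
  assumes "x \<in> I"
  shows "(T ^^ birkhoff_sum T h n x) (\<phi> x) = \<phi> ((T ^^ n) x)"
    and "birkhoff_sum T f (birkhoff_sum T h n x) (\<phi> x) = birkhoff_sum T (ren f) n x"
proof -
  show *: "(T ^^ birkhoff_sum T h n x) (\<phi> x) = \<phi> ((T ^^ n) x)" for n
    by (rule funpow_return[where S = I and T' = T and h = h and \<phi> = \<phi>, OF T_in return_\<phi> assms])
  show "birkhoff_sum T f (birkhoff_sum T h n x) (\<phi> x) = birkhoff_sum T (ren f) n x"
    by (induction n) (simp_all add: birkhoff_sum_Suc birkhoff_sum_add ren_def *)
qed

lemma decompose_time:
  assumes "x \<in> I"
  shows "\<exists>n r. r < hmax \<and> N = birkhoff_sum T h n x + r"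
proof -
  \<comment> \<open>The induction needs the remainder to stay below the current return time; the
    uniform bound \<open>hmax\<close> is only introduced at the end.\<close>
  have "\<exists>n r. r < h ((T ^^ n) x) \<and> N = birkhoff_sum T h n x + r"
  proof (induction N)
    case 0
    then show ?case using h_pos[OF assms] by (intro exI[of _ 0]) simp
  next
    case (Suc N)
    then obtain n r where nr: "r < h ((T ^^ n) x)" "N = birkhoff_sum T h n x + r" by blast
    show ?case
    proof (cases "Suc r < h ((T ^^ n) x)")
      case True
      with nr show ?thesis by (intro exI[of _ n] exI[of _ "Suc r"]) simp
    next
      case False
      with nr h_pos[OF orbit_in[OF assms, of "Suc n"]] show ?thesis
        by (intro exI[of _ "Suc n"] exI[of _ 0]) (simp add: birkhoff_sum_Suc)
    qed
  qed
  then obtain n r where "r < h ((T ^^ n) x)" "N = birkhoff_sum T h n x + r" by blast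
  then show ?thesis using h_le[OF orbit_in[OF assms, of n]]
    by (intro exI[of _ n] exI[of _ r]) simp
qed

text \<open>
  After a bounded time an orbit enters the image of \<open>\<phi>\<close>, and from there it splits into complete blocks,
  whose sums are values of \<open>ren f\<close>, and a remainder of bounded length.
\<close>

lemma birkhoff_bounded_below:
  assumes "\<And>x. x \<in> I \<Longrightarrow> \<bar>f x\<bar> \<le> K" "\<And>x. x \<in> I \<Longrightarrow> 0 \<le> (ren ^^ n) f x"
  shows "\<exists>C. \<forall>x\<in>I. \<forall>N. - C \<le> birkhoff_sum T f N x"
  using assms
proof (induction n arbitrary: f K)
  case 0
  then show ?case
    by (intro exI[of _ 0]) (auto simp: birkhoff_sum_def intro!: sum_nonneg orbit_in)
next
  case (Suc n)
  have K: "0 \<le> K" using Suc.prems(1)[of 0] by (auto simp: I_def)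
  have short: "\<bar>birkhoff_sum T f N x\<bar> \<le> N * K" if "x \<in> I" for N x
    using that by (intro abs_birkhoff_sum_le Suc.prems orbit_in)
  have "\<bar>ren f x\<bar> \<le> hmax * K" if "x \<in> I" for x
  proof -
    have "h x * K \<le> hmax * K" using h_le[OF that] K by (simp add: mult_right_mono)
    with short[OF \<phi>_in[OF that], of "h x"] show ?thesis by (simp add: ren_def)
  qed
  moreover have "0 \<le> (ren ^^ n) (ren f) x" if "x \<in> I" for x
    using Suc.prems(2)[OF that] by (simp add: funpow_swap1)
  ultimately obtain C where C: "\<And>x N. x \<in> I \<Longrightarrow> - C \<le> birkhoff_sum T (ren f) N x"
    using Suc.IH[of "ren f" "hmax * K"] by blast
  have C0: "0 \<le> C" using C[of 0 0] by (auto simp: I_def)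
  \<comment> \<open>On an orbit starting in the copy, \<open>C\<close> pays for the complete blocks
    and \<open>hmax * K\<close> for the remainder.\<close>
  have low: "- C - hmax * K \<le> birkhoff_sum T f N (\<phi> y)" if y: "y \<in> I" for y N
  proof -
    obtain j r where jr: "r < hmax" "N = birkhoff_sum T h j y + r" using decompose_time[OF y] by blast
    have "r * K \<le> hmax * K" using jr K by (simp add: mult_right_mono)
    then have "- (hmax * K) \<le> birkhoff_sum T f r (\<phi> ((T ^^ j) y))"
      using short[OF \<phi>_in[OF orbit_in[OF y, of j]], of r] by linarith
    then show ?thesis
      using C[OF y, of j] by (simp add: jr birkhoff_sum_add orbit_from_\<phi>[OF y])
  qed
  have "- (b * K + C + hmax * K) \<le> birkhoff_sum T f N x" if x: "x \<in> I" for x N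
  proof -
    obtain k y where ky: "k \<le> b" "y \<in> I" "(T ^^ k) x = \<phi> y" using hits[OF x] by blast
    have b: "real j * K \<le> b * K" if "j \<le> b" for j using that K by (simp add: mult_right_mono)
    have nn: "0 \<le> hmax * K" using K by simp
    show ?thesis
    proof (cases "N \<le> k")
      case True
      then show ?thesis using short[OF x, of N] b[of N] ky C0 nn by linarith
    next
      case False
      then have "birkhoff_sum T f N x = birkhoff_sum T f k x + birkhoff_sum T f (N - k) (\<phi> y)"
        using birkhoff_sum_add[of T f k "N - k" x] ky by simp
      then show ?thesis using short[OF x, of k] b[OF ky(1)] low[OF ky(2), of "N - k"] by linarith
    qed
  qed
  then show ?case by blast
qed

text \<open>Towers over points of one cell run through the same cells in the same order, and each
  level contracts the distance of corresponding floors by \<open>\<rho>\<close>.\<close>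

lemma ren_pow_osc:
  assumes f: "\<And>x y. x \<in> I \<Longrightarrow> y \<in> I \<Longrightarrow> \<bar>f x - f y\<bar> \<le> \<kappa> * \<bar>x - y\<bar>"
    and "x \<in> I" "y \<in> I" "cell x = cell y"
  shows "\<bar>(ren ^^ n) f x - (ren ^^ n) f y\<bar> \<le> \<kappa> * \<rho> ^ n * \<bar>x - y\<bar> * height n x"
  using assms(2-)
proof (induction n arbitrary: x y)
  case (Suc n)
  have hh: "h y = h x" using h_cell Suc.prems by metis
  have "\<bar>(ren ^^ Suc n) f x - (ren ^^ Suc n) f y\<bar>
      \<le> (\<Sum>k<h x. \<bar>(ren ^^ n) f ((T ^^ k) (\<phi> x)) - (ren ^^ n) f ((T ^^ k) (\<phi> y))\<bar>)"
    unfolding ren_pow_Suc hh by (simp flip: sum_subtractf)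
  also have "\<dots> \<le> (\<Sum>k<h x. \<kappa> * \<rho> ^ n * (\<rho> * \<bar>x - y\<bar>) * height n ((T ^^ k) (\<phi> x)))"
  proof (rule sum_mono)
    fix k assume "k \<in> {..<h x}"
    then have k: "k < h x" by simp
    show "\<bar>(ren ^^ n) f ((T ^^ k) (\<phi> x)) - (ren ^^ n) f ((T ^^ k) (\<phi> y))\<bar>
        \<le> \<kappa> * \<rho> ^ n * (\<rho> * \<bar>x - y\<bar>) * height n ((T ^^ k) (\<phi> x))"
      using Suc.IH[OF orbit_in[OF \<phi>_in[OF Suc.prems(1)]] orbit_in[OF \<phi>_in[OF Suc.prems(2)]] cell_orbit[OF Suc.prems k]]
      by (simp add: dist_orbit[OF Suc.prems k])
  qed
  also have "\<dots> = \<kappa> * \<rho> ^ Suc n * \<bar>x - y\<bar> * height (Suc n) x"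
    by (simp add: height_Suc sum_distrib_left algebra_simps)
  finally show ?case .
qed (use f in simp)

lemma height_cell:
  assumes "x \<in> I" "y \<in> I" "cell x = cell y"
  shows "height n x = height n y"
  using ren_pow_osc[of "\<lambda>_. 1" 0, OF _ assms, of n] by (simp add: height_def)

text \<open>Higher towers are concatenations of towers of level \<open>n\<close>, so a lower bound
  for averages is inherited.\<close>

lemma ren_lower_bound:
  assumes "\<And>x. x \<in> I \<Longrightarrow> c * height n x \<le> (ren ^^ n) f x" "x \<in> I"
  shows "c * height (j + n) x \<le> (ren ^^ (j + n)) f x"
  using assms(2)
proof (induction j arbitrary: x)
  case (Suc j)
  have "c * height (Suc (j + n)) x = (\<Sum>k<h x. c * height (j + n) ((T ^^ k) (\<phi> x)))"
    by (simp add: height_Suc sum_distrib_left)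
  also have "\<dots> \<le> (\<Sum>k<h x. (ren ^^ (j + n)) f ((T ^^ k) (\<phi> x)))"
    using Suc orbit_in \<phi>_in by (intro sum_mono) auto
  finally show ?case by (simp only: add_Suc ren_pow_Suc)
qed (use assms in simp)

text \<open>The tower contains one of level \<open>n\<close> over the cell \<open>i\<close>, with
  surplus \<open>g\<close>. The height grows by a factor of at most \<open>Q\<close> per level, so
  the surplus keeps a share of \<open>1 / Q ^ j\<close>.\<close>

lemma ren_lower_bound_reach:
  assumes low: "\<And>x. x \<in> I \<Longrightarrow> c * height n x \<le> (ren ^^ n) f x"
    and gain: "\<And>x. x \<in> I \<Longrightarrow> cell x = i \<Longrightarrow> (c + g) * height n x \<le> (ren ^^ n) f x"
    and g: "0 \<le> g" and Q: "0 < Q" "hmax * V\<^sup>2 \<le> Q" and "x \<in> I" "reaches T \<phi> h cell j i x"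
  shows "(c + g / Q ^ j) * height (j + n) x \<le> (ren ^^ (j + n)) f x"
  using assms(6,7)
proof (induction j arbitrary: x)
  case 0
  then show ?case using gain by simp
next
  case (Suc j)
  let ?F = "(ren ^^ (j + n)) f" and ?x = "\<lambda>k. (T ^^ k) (\<phi> x)"
  obtain k where k: "k < h x" "reaches T \<phi> h cell j i (?x k)" using Suc.prems by auto
  have in_I: "?x k \<in> I" for k using Suc.prems orbit_in \<phi>_in by blast
  have "g / Q ^ Suc j * height (Suc (j + n)) x \<le> g / Q ^ Suc j * (Q * height (j + n) (?x k))"
  proof (intro mult_left_mono)
    have "hmax * V\<^sup>2 * height (j + n) (?x k) \<le> Q * height (j + n) (?x k)"
      using Q height_pos[OF in_I] by (intro mult_right_mono) (auto intro: less_imp_le)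
    then show "height (Suc (j + n)) x \<le> Q * height (j + n) (?x k)"
      using height_Suc_le[OF Suc.prems(1) in_I, of "j + n" k] by linarith
  qed (use g Q in simp)
  also have "\<dots> = g / Q ^ j * height (j + n) (?x k)" using Q by simp
  also have "\<dots> \<le> ?F (?x k) - c * height (j + n) (?x k)"
    using Suc.IH[OF in_I k(2)] by (simp add: algebra_simps)
  \<comment> \<open>No summand is negative, so the one subtower known to carry the surplus bounds
    the sum from below.\<close>
  also have "\<dots> \<le> (\<Sum>k<h x. ?F (?x k) - c * height (j + n) (?x k))"
    using k(1) ren_lower_bound[OF low in_I, of j] by (intro member_le_sum) auto
  also have "\<dots> = (ren ^^ Suc (j + n)) f x - c * height (Suc (j + n)) x"
    unfolding ren_pow_Suc height_Suc by (simp add: sum_subtractf sum_distrib_left)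
  finally show ?case by (simp add: algebra_simps)
qed

text \<open>The averages of \<open>f\<close> over all towers of some level lie within
  \<open>e\<close> of one constant, with the heights multiplied out.\<close>

definition almost_const :: "(real \<Rightarrow> real) \<Rightarrow> real \<Rightarrow> bool" where
  "almost_const f e \<longleftrightarrow> (\<exists>n c. \<forall>x\<in>I. \<bar>(ren ^^ n) f x - c * height n x\<bar> \<le> e * height n x)"

lemma ren_pow_uminus: "(ren ^^ n) (\<lambda>x. - f x) x = - (ren ^^ n) f x"
  using ren_pow_linear[of n "- 1" f 0 "\<lambda>_. 0" x] by simp

lemma almost_const_uminus:
  assumes "almost_const (\<lambda>x. - f x) e"
  shows "almost_const f e"
proof -
  obtain n c where nc: "\<And>x. x \<in> I \<Longrightarrow> \<bar>- (ren ^^ n) f x - c * height n x\<bar> \<le> e * height n x"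
    using assms unfolding almost_const_def ren_pow_uminus by blast
  have "\<bar>(ren ^^ n) f x - (- c) * height n x\<bar> \<le> e * height n x" if "x \<in> I" for x
    using nc[OF that] by (simp add: abs_le_iff)
  then show ?thesis unfolding almost_const_def by blast
qed

text \<open>
  Suppose the average of \<open>f\<close> over some tower is at least \<open>c\<close>. As \<open>f\<close> varies little within the cells, the
  same holds up to \<open>e/2\<close> for all towers over that cell, and every tower of level \<open>m\<close> further up contains one
  of these in a fixed proportion.
\<close>

lemma osc_contraction:
  assumes f: "\<And>x y. x \<in> I \<Longrightarrow> y \<in> I \<Longrightarrow> \<bar>f x - f y\<bar> \<le> \<kappa> * \<bar>x - y\<bar>"
    and e: "0 < e" "almost_const f e" and Q: "0 < Q" "hmax * V\<^sup>2 \<le> Q"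
  shows "almost_const f ((1 - 1 / (4 * Q ^ m)) * e)"
proof -
  have \<kappa>: "0 \<le> \<kappa>" using order_trans[OF abs_ge_zero f[of 0 "1/2"]] by (auto simp: I_def)
  obtain n0 c where n0: "\<And>x. x \<in> I \<Longrightarrow> \<bar>(ren ^^ n0) f x - c * height n0 x\<bar> \<le> e * height n0 x"
    using e(2) by (auto simp: almost_const_def)
  have one_sided: "almost_const g ((1 - 1 / (4 * Q ^ m)) * e)"
    if g: "\<And>x y. x \<in> I \<Longrightarrow> y \<in> I \<Longrightarrow> \<bar>g x - g y\<bar> \<le> \<kappa> * \<bar>x - y\<bar>"
      and lo: "\<And>x. x \<in> I \<Longrightarrow> (d - e) * height n x \<le> (ren ^^ n) g x"
      and up: "\<And>x. x \<in> I \<Longrightarrow> (ren ^^ n) g x \<le> (d + e) * height n x"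
      and n: "\<kappa> * \<rho> ^ n \<le> e / 2"
      and z: "z \<in> I" "d * height n z \<le> (ren ^^ n) g z" for g d n z
  proof -
    have gain: "(d - e + e / 2) * height n x \<le> (ren ^^ n) g x" if x: "x \<in> I" "cell x = cell z" for x
    proof -
      have "\<kappa> * \<rho> ^ n * \<bar>z - x\<bar> \<le> (e / 2) * 1"
        using n x z \<kappa> contraction e(1) by (intro mult_mono) (auto simp: I_def)
      then have "\<kappa> * \<rho> ^ n * \<bar>z - x\<bar> * height n z \<le> e / 2 * height n z"
        using height_pos[OF z(1), of n] by (intro mult_right_mono) auto
      then have "(ren ^^ n) g z - (ren ^^ n) g x \<le> e / 2 * height n z"
        using ren_pow_osc[of g \<kappa> z x n] g z x by force
      with z(2) show ?thesis
        using height_cell[OF x(1) z(1) x(2), of n] by (simp add: algebra_simps)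
    qed
    \<comment> \<open>The lower end of the range of averages rises by \<open>2 * s * e\<close>: the
      centre moves by \<open>s * e\<close> and the radius shrinks to
      \<open>(1 - s) * e\<close>.\<close>
    define s where "s = 1 / (4 * Q ^ m)"
    have "\<bar>(ren ^^ (m + n)) g x - (d + s * e) * height (m + n) x\<bar> \<le> (1 - s) * e * height (m + n) x"
      if x: "x \<in> I" for x
    proof -
      have low: "(d - e + e / 2 / Q ^ m) * height (m + n) x \<le> (ren ^^ (m + n)) g x"
        by (rule ren_lower_bound_reach[OF lo gain _ Q x primitive[OF x z(1)]]) (use e in auto)
      have "e / 2 / Q ^ m = 2 * s * e" by (simp add: s_def)
      note low = low[unfolded this]
      have "(- d - e) * height (m + n) x \<le> (ren ^^ (m + n)) (\<lambda>x. - g x) x"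
        by (rule ren_lower_bound[OF _ x]) (use up in \<open>auto simp: ren_pow_uminus algebra_simps\<close>)
      then show ?thesis
        using low by (intro abs_leI) (simp_all add: ren_pow_uminus algebra_simps)
    qed
    then show ?thesis unfolding almost_const_def s_def by blast
  qed
  \<comment> \<open>The level is raised until the oscillation within a cell is below
    \<open>e / 2\<close>; the bounds known at level \<open>n0\<close> persist.\<close>
  have "(\<lambda>n. \<kappa> * \<rho> ^ n) \<longlonglongrightarrow> \<kappa> * 0"
    using contraction by (intro tendsto_intros LIMSEQ_power_zero) auto
  then have "\<forall>\<^sub>F n in sequentially. \<kappa> * \<rho> ^ n < e / 2"
    using e by (intro order_tendstoD) auto
  then obtain j where "\<And>n. j \<le> n \<Longrightarrow> \<kappa> * \<rho> ^ n < e / 2" by (auto simp: eventually_sequentially)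
  from this[of "j + n0"] have j: "\<kappa> * \<rho> ^ (j + n0) \<le> e / 2" by simp
  define n where "n = j + n0"
  have lo: "(c - e) * height n x \<le> (ren ^^ n) f x" if "x \<in> I" for x
    unfolding n_def by (rule ren_lower_bound[OF _ that]) (use n0 in \<open>force simp: abs_le_iff algebra_simps\<close>)
  have "(- c - e) * height n x \<le> (ren ^^ n) (\<lambda>x. - f x) x" if "x \<in> I" for x
    unfolding n_def by (rule ren_lower_bound[OF _ that]) (use n0 in \<open>force simp: ren_pow_uminus abs_le_iff algebra_simps\<close>)
  then have up: "(ren ^^ n) f x \<le> (c + e) * height n x" if "x \<in> I" for x
    using that by (force simp: ren_pow_uminus algebra_simps)
  show ?thesis
  proof (cases "\<exists>z\<in>I. c * height n z \<le> (ren ^^ n) f z")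
    case True
    then show ?thesis using one_sided[OF f lo up] j unfolding n_def by blast
  next
    case False
    \<comment> \<open>Now all averages lie below \<open>c\<close>. The same argument for
      \<open>- f\<close> lowers the upper end, and any point, here \<open>0\<close>, is a
      witness.\<close>
    have "almost_const (\<lambda>x. - f x) ((1 - 1 / (4 * Q ^ m)) * e)"
    proof (rule one_sided[of _ "- c" n 0])
      show "\<bar>- f x - - f y\<bar> \<le> \<kappa> * \<bar>x - y\<bar>" if "x \<in> I" "y \<in> I" for x y
        using f[OF that] by simp
    qed (use up lo j False in \<open>auto simp: ren_pow_uminus n_def I_def algebra_simps not_le intro: less_imp_le\<close>)
    then show ?thesis by (rule almost_const_uminus)
  qed
qed

text \<open>Each use of \<open>osc_contraction\<close> multiplies the error by the same factor below
  \<open>1\<close>, starting from the sup bound.\<close>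

lemma almost_const_Lipschitz:
  assumes f: "\<And>x y. x \<in> I \<Longrightarrow> y \<in> I \<Longrightarrow> \<bar>f x - f y\<bar> \<le> \<kappa> * \<bar>x - y\<bar>"
    and bound: "\<And>x. x \<in> I \<Longrightarrow> \<bar>f x\<bar> \<le> K" and e: "0 < e"
  shows "almost_const f e"
proof -
  \<comment> \<open>The summand \<open>1\<close> gives \<open>1 \<le> Q\<close>, hence
    \<open>0 < 1 - s < 1\<close>; likewise \<open>K'\<close> is made positive because
    \<open>osc_contraction\<close> needs a positive error.\<close>
  define Q where "Q = hmax * V\<^sup>2 + 1"
  define s where "s = 1 / (4 * Q ^ m)"
  define K' where "K' = \<bar>K\<bar> + 1"
  have Q: "1 \<le> Q" "hmax * V\<^sup>2 \<le> Q" by (auto simp: Q_def)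
  then have "1 \<le> Q ^ m" by simp
  then have s: "0 < s" "s < 1" by (auto simp: s_def field_simps)
  have "almost_const f ((1 - s) ^ j * K')" for j
  proof (induction j)
    case 0
    have "\<bar>f x\<bar> \<le> K'" if "x \<in> I" for x using bound[OF that] by (simp add: K'_def)
    then show ?case unfolding almost_const_def by (intro exI[of _ 0]) auto
  next
    case (Suc j)
    have "0 < (1 - s) ^ j * K'" using s by (auto simp: K'_def intro!: mult_pos_pos)
    from osc_contraction[OF f this Suc, of Q] Q show ?case by (simp add: s_def mult.assoc)
  qed
  moreover have "(\<lambda>j. (1 - s) ^ j * K') \<longlonglongrightarrow> 0 * K'"
    using s by (intro tendsto_intros LIMSEQ_power_zero) auto
  then have "\<forall>\<^sub>F j in sequentially. (1 - s) ^ j * K' < e"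
    using e by (intro order_tendstoD) auto
  then obtain j where j: "(1 - s) ^ j * K' < e" by (auto simp: eventually_sequentially)
  ultimately obtain n c where nc: "\<And>x. x \<in> I \<Longrightarrow> \<bar>(ren ^^ n) f x - c * height n x\<bar> \<le> (1 - s) ^ j * K' * height n x"
    unfolding almost_const_def by metis
  have "(1 - s) ^ j * K' * height n x \<le> e * height n x" if "x \<in> I" for x
    using j height_pos[OF that, of n] by (intro mult_right_mono) auto
  with nc show ?thesis unfolding almost_const_def by (meson order_trans)
qed

text \<open>The constant \<open>c\<close> is chosen before the measure, so that two invariant
  measures can be compared through it. Over towers of one level both \<open>f - c + e\<close> and
  \<open>c + e - f\<close> have nonnegative sums, so their Birkhoff sums are bounded below and their
  integrals nonnegative.\<close>

lemma integral_almost_const: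
  assumes f: "\<And>x y. x \<in> I \<Longrightarrow> y \<in> I \<Longrightarrow> \<bar>f x - f y\<bar> \<le> \<kappa> * \<bar>x - y\<bar>"
    and bound: "\<And>x. x \<in> I \<Longrightarrow> \<bar>f x\<bar> \<le> K" and meas: "f \<in> borel_measurable borel" and e: "0 < e"
  shows "\<exists>c. \<forall>M. sets M = sets (restrict_space borel I) \<and> finite_measure M \<and> invariant_measure T M \<longrightarrow>
    \<bar>integral\<^sup>L M f - c * measure M I\<bar> \<le> e * measure M I"
proof -
  obtain n c where nc: "\<And>x. x \<in> I \<Longrightarrow> \<bar>(ren ^^ n) f x - c * height n x\<bar> \<le> e * height n x"
    using almost_const_Lipschitz[OF f bound e] unfolding almost_const_def by blast
  have one_sided: "0 \<le> a * integral\<^sup>L M f + d * measure M I"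
    if M: "sets M = sets (restrict_space borel I)" "finite_measure M" "invariant_measure T M"
      and nonneg: "\<And>x. x \<in> I \<Longrightarrow> 0 \<le> a * (ren ^^ n) f x + d * height n x" for M a d
  proof -
    interpret finite_measure M by fact
    have sp: "space M = I"
      using sets_eq_imp_space_eq[OF M(1)] by (simp add: space_restrict_space)
    have "f \<in> borel_measurable M"
      using measurable_restrict_space1[OF meas, of I] measurable_cong_sets[OF M(1) refl] by blast
    then have int: "integrable M f"
      using bound sp by (intro integrable_const_bound[of _ K]) auto
    let ?g = "\<lambda>x. a * f x + d * 1"
    have "\<bar>?g x\<bar> \<le> \<bar>a\<bar> * K + \<bar>d\<bar>" if "x \<in> I" for x
      using abs_triangle_ineq[of "a * f x" d] mult_left_mono[OF bound[OF that] abs_ge_zero[of a]]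
      by (simp add: abs_mult)
    moreover have "0 \<le> (ren ^^ n) ?g x" if "x \<in> I" for x
      using nonneg[OF that] unfolding ren_pow_linear by (simp add: height_def)
    ultimately obtain C where C: "\<And>x N. x \<in> I \<Longrightarrow> - C \<le> birkhoff_sum T ?g N x"
      using birkhoff_bounded_below[of ?g "\<bar>a\<bar> * K + \<bar>d\<bar>" n] by blast
    have "0 \<le> (\<integral>x. ?g x \<partial>M)"
      using C sp int by (intro integral_nonneg_if_birkhoff_bounded_below[OF M(2,3)]) auto
    then show ?thesis using int sp by (simp add: mult.commute)
  qed
  show ?thesis
  proof (intro exI[of _ c] allI impI)
    fix M :: "real measure"
    assume M: "sets M = sets (restrict_space borel I) \<and> finite_measure M \<and> invariant_measure T M"
    have "0 \<le> 1 * integral\<^sup>L M f + (e - c) * measure M I"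
      by (rule one_sided) (use M nc in \<open>auto simp: abs_le_iff algebra_simps\<close>)
    moreover have "0 \<le> - 1 * integral\<^sup>L M f + (e + c) * measure M I"
      by (rule one_sided) (use M nc in \<open>auto simp: abs_le_iff algebra_simps\<close>)
    ultimately show "\<bar>integral\<^sup>L M f - c * measure M I\<bar> \<le> e * measure M I"
      by (simp add: abs_le_iff algebra_simps)
  qed
qed

text \<open>\<open>M\<close> and Lebesgue measure are compared through the same \<open>c\<close>, so
  integrals of Lipschitz functions agree up to the factor \<open>\<mu>\<close>. Lipschitz ramps
  converge to indicators of rays, and rays determine the measure.\<close>

theorem uniquely_ergodic:
  assumes inv: "invariant_measure T (restrict_space lborel I)"
  shows "uniquely_ergodic_on I T"
  unfolding uniquely_ergodic_on_def
proof (intro conjI allI impI)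
  let ?L = "restrict_space lborel I"
  fix M :: "real measure"
  assume M: "sets M = sets (restrict_space borel I) \<and> finite_measure M \<and> invariant_measure T M"
  then interpret M: finite_measure M by simp
  have I_borel: "I \<in> sets borel" by (simp add: I_def)
  have emL: "emeasure ?L I = 1" by (subst emeasure_restrict_space) (auto simp: I_def)
  have sL: "space ?L = I" by (simp add: space_restrict_space)
  interpret L: finite_measure ?L by (rule finite_measureI) (simp add: sL emL)
  have mL: "measure ?L I = 1" by (simp add: measure_def emL)
  have setsL: "sets ?L = sets (restrict_space borel I)" by (simp add: sets_restrict_space)
  have sM: "space M = I" using sets_eq_imp_space_eq[of M "restrict_space borel I"] M by (simp add: space_restrict_space)
  define \<mu> where "\<mu> = measure M I"
  have \<mu>: "0 \<le> \<mu>" by (simp add: \<mu>_def)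
  have integral_eq: "integral\<^sup>L M f = \<mu> * integral\<^sup>L ?L f"
    if f: "\<And>x y. x \<in> I \<Longrightarrow> y \<in> I \<Longrightarrow> \<bar>f x - f y\<bar> \<le> \<kappa> * \<bar>x - y\<bar>"
      and bound: "\<And>x. x \<in> I \<Longrightarrow> \<bar>f x\<bar> \<le> K" and meas: "f \<in> borel_measurable borel" for f \<kappa> K
  proof -
    have le: "\<bar>integral\<^sup>L M f - \<mu> * integral\<^sup>L ?L f\<bar> \<le> e * (2 * \<mu>)" if e: "0 < e" for e
    proof -
      obtain c where c: "\<And>M. sets M = sets (restrict_space borel I) \<and> finite_measure M \<and> invariant_measure T M \<Longrightarrow>
          \<bar>integral\<^sup>L M f - c * measure M I\<bar> \<le> e * measure M I"
        using integral_almost_const[OF f bound meas e] by blast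
      have "\<bar>integral\<^sup>L M f - c * \<mu>\<bar> \<le> e * \<mu>" using c[OF M] by (simp add: \<mu>_def)
      moreover have "\<bar>integral\<^sup>L ?L f - c\<bar> \<le> e" using c[of ?L] inv setsL L.finite_measure_axioms by (simp add: mL)
      then have "\<mu> * \<bar>integral\<^sup>L ?L f - c\<bar> \<le> \<mu> * e" using \<mu> by (rule mult_left_mono)
      then have "\<bar>\<mu> * integral\<^sup>L ?L f - c * \<mu>\<bar> \<le> e * \<mu>"
        using \<mu> abs_mult[of \<mu> "integral\<^sup>L ?L f - c"] by (simp add: right_diff_distrib mult.commute)
      ultimately show ?thesis by linarith
    qed
    have "\<bar>integral\<^sup>L M f - \<mu> * integral\<^sup>L ?L f\<bar> \<le> 0"
    proof (rule field_le_epsilon)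
      fix e :: real assume e: "0 < e"
      \<comment> \<open>The \<open>+ 1\<close> avoids a division by zero when \<open>M\<close> is
        the zero measure.\<close>
      have "e / (2 * \<mu> + 1) * (2 * \<mu>) \<le> e" using e \<mu> by (simp add: field_simps)
      then show "\<bar>integral\<^sup>L M f - \<mu> * integral\<^sup>L ?L f\<bar> \<le> 0 + e"
        using le[of "e / (2 * \<mu> + 1)"] e \<mu> by simp
    qed
    then show ?thesis by simp
  qed
  have measure_eq: "measure M ({x<..} \<inter> I) = \<mu> * measure ?L ({x<..} \<inter> I)" for x
  proof -
    \<comment> \<open>A ramp from \<open>0\<close> at \<open>x\<close> with slope \<open>n\<close>,
      capped at \<open>1\<close>; as it vanishes at \<open>x\<close>, the limit is the indicator of
      the open ray.\<close>
    define f where "f n y = min 1 (max 0 (real n * (y - x)))" for n y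
    have f_meas: "f n \<in> borel_measurable borel" for n unfolding f_def by measurable
    have f_bound: "\<bar>f n y\<bar> \<le> 1" for n y by (auto simp: f_def)
    have f_Lip: "\<bar>f n y - f n z\<bar> \<le> real n * \<bar>y - z\<bar>" for n y z
    proof -
      have "\<bar>f n y - f n z\<bar> \<le> \<bar>real n * (y - x) - real n * (z - x)\<bar>" unfolding f_def by linarith
      also have "\<dots> = real n * \<bar>y - z\<bar>" by (simp add: abs_mult flip: right_diff_distrib)
      finally show ?thesis .
    qed
    have f_lim: "(\<lambda>n. f n y) \<longlonglongrightarrow> indicator {x<..} y" for y
    proof (cases "x < y")
      case True
      obtain k :: nat where k: "1 < k * (y - x)" using True reals_Archimedean3[of "y - x"] by auto
      have "f n y = 1" if "k \<le> n" for n
      proof -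
        have "k * (y - x) \<le> n * (y - x)" using that True by (simp add: mult_right_mono)
        with k show ?thesis by (simp add: f_def)
      qed
      then have "\<forall>\<^sub>F n in sequentially. f n y = 1" by (auto simp: eventually_sequentially)
      then show ?thesis using True by (simp add: tendsto_eventually)
    next
      case False
      then have "f n y = 0" for n by (simp add: f_def mult_nonneg_nonpos)
      then show ?thesis using False by simp
    qed
    have lim: "(\<lambda>n. integral\<^sup>L N (f n)) \<longlonglongrightarrow> measure N ({x<..} \<inter> I)"
      if N: "finite_measure N" "sets N = sets (restrict_space borel I)" for N
    proof -
      interpret N: finite_measure N by fact
      have sp: "space N = I" using sets_eq_imp_space_eq[OF N(2)] by (simp add: space_restrict_space)
      have meas: "g \<in> borel_measurable N" if "g \<in> borel_measurable borel" for g :: "real \<Rightarrow> real"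
        using measurable_restrict_space1[OF that, of I] measurable_cong_sets[OF N(2) refl] by blast
      have "(\<lambda>n. integral\<^sup>L N (f n)) \<longlonglongrightarrow> (\<integral>y. indicator {x<..} y \<partial>N)"
      proof (rule integral_dominated_convergence[where w = "\<lambda>_. 1"])
        show "f n \<in> borel_measurable N" for n by (rule meas[OF f_meas])
        show "(indicator {x<..} :: real \<Rightarrow> real) \<in> borel_measurable N" by (rule meas) simp
        show "AE y in N. (\<lambda>n. f n y) \<longlonglongrightarrow> (indicator {x<..} y :: real)" by (simp add: f_lim)
        show "AE y in N. norm (f n y) \<le> 1" for n by (simp add: f_bound)
      qed simp
      then show ?thesis by (simp add: sp)
    qed
    have "integral\<^sup>L M (f n) = \<mu> * integral\<^sup>L ?L (f n)" for n
      using integral_eq[OF f_Lip f_bound f_meas] by simp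
    moreover have "(\<lambda>n. \<mu> * integral\<^sup>L ?L (f n)) \<longlonglongrightarrow> \<mu> * measure ?L ({x<..} \<inter> I)"
      by (intro tendsto_intros lim setsL L.finite_measure_axioms)
    ultimately show ?thesis
      using lim[OF M.finite_measure_axioms] M LIMSEQ_unique by auto
  qed
  let ?S = "scale_measure (ennreal \<mu>) ?L"
  have idM: "(\<lambda>x. x) \<in> M \<rightarrow>\<^sub>M borel"
    using measurable_restrict_space1[of "\<lambda>x. x" borel borel I] measurable_cong_sets[of M "restrict_space borel I" borel borel] M by auto
  have idS: "(\<lambda>x. x) \<in> ?S \<rightarrow>\<^sub>M borel"
    using measurable_restrict_space1[of "\<lambda>x. x" borel borel I] measurable_cong_sets[of ?S "restrict_space borel I" borel borel] setsL by auto
  \<comment> \<open>Rays characterize Borel measures on the whole line, so both measures are first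
    pushed forward along the inclusion.\<close>
  have eq: "distr M borel (\<lambda>x. x) = distr ?S borel (\<lambda>x. x)"
  proof (rule measure_eqI_lessThan)
    fix x :: real
    show "emeasure (distr M borel (\<lambda>x. x)) {x<..} < \<infinity>"
      using idM by (simp add: emeasure_distr M.emeasure_eq_measure)
    have "emeasure M ({x<..} \<inter> I) = emeasure ?S ({x<..} \<inter> I)"
      using measure_eq[of x] \<mu> by (simp add: M.emeasure_eq_measure L.emeasure_eq_measure ennreal_mult)
    then show "emeasure (distr M borel (\<lambda>x. x)) {x<..} = emeasure (distr ?S borel (\<lambda>x. x)) {x<..}"
      using idM idS by (simp add: emeasure_distr sM sL space_scale_measure)
  qed simp_all
  have "M = ?S"
  proof (rule measure_eqI)
    show "sets M = sets ?S" using M setsL by simp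
    fix A assume A: "A \<in> sets M"
    then have A': "A \<in> sets borel" "A \<subseteq> I"
      using M I_borel by (auto simp: sets_restrict_space_iff)
    have "emeasure (distr M borel (\<lambda>x. x)) A = emeasure (distr ?S borel (\<lambda>x. x)) A" by (simp add: eq)
    then show "emeasure M A = emeasure ?S A"
      using idM idS A' by (simp add: emeasure_distr sM sL space_scale_measure Int_absorb2)
  qed
  then show "\<exists>c. M = scale_measure c ?L" by blast
qed (rule inv)

end

section \<open>The tribonacci constant\<close>

text \<open>The reciprocal of the tribonacci constant. The tight rational enclosure belongs to the
  choice because the order of the cuts is later decided by linear arithmetic from such
  bounds.\<close>

definition tri :: real ("\<alpha>") where
  "\<alpha> = (SOME x. 543689 / 1000000 \<le> x \<and> x \<le> 543690 / 1000000 \<and> x ^ 3 + x ^ 2 + x = 1)"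

text \<open>A separate constant, so that linear arithmetic treats \<open>\<alpha>\<close> and its
  square as two atoms.\<close>

definition tri_sq :: real ("\<beta>") where "\<beta> = \<alpha>\<^sup>2"

lemma tri_spec: "543689 / 1000000 \<le> \<alpha>" "\<alpha> \<le> 543690 / 1000000" "\<alpha> ^ 3 + \<beta> + \<alpha> = 1"
proof -
  have "\<exists>x::real. 543689 / 1000000 \<le> x \<and> x \<le> 543690 / 1000000 \<and> x ^ 3 + x ^ 2 + x = 1"
    by (rule IVT) (auto intro!: continuous_intros simp: power3_eq_cube power2_eq_square)
  from someI_ex[OF this] show "543689 / 1000000 \<le> \<alpha>" "\<alpha> \<le> 543690 / 1000000" "\<alpha> ^ 3 + \<beta> + \<alpha> = 1"
    unfolding tri_def tri_sq_def by auto
qed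

lemma tri_sq_bounds: "295597 / 1000000 \<le> \<beta>" "\<beta> \<le> 295599 / 1000000"
proof -
  have "(543689 / 1000000)\<^sup>2 \<le> \<beta>" "\<beta> \<le> (543690 / 1000000)\<^sup>2"
    using tri_spec(1,2) unfolding tri_sq_def by (auto intro!: power_mono)
  then show "295597 / 1000000 \<le> \<beta>" "\<beta> \<le> 295599 / 1000000"
    by (auto simp: power2_eq_square)
qed

lemmas tri_bounds = tri_spec(1,2) tri_sq_bounds

lemma tri_pos: "0 < \<alpha>" "0 < \<beta>" "\<beta> < 1"
  using tri_bounds by linarith+

lemma tri_mult: "\<beta> * \<alpha> = 1 - \<alpha> - \<beta>" "\<beta> * \<beta> = 2 * \<alpha> - 1"
proof -
  show *: "\<beta> * \<alpha> = 1 - \<alpha> - \<beta>"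
    using tri_spec(3) by (simp add: power3_eq_cube power2_eq_square tri_sq_def)
  have "\<beta> * \<beta> = \<alpha> * (\<beta> * \<alpha>)" by (simp add: power2_eq_square tri_sq_def)
  also have "\<dots> = 2 * \<alpha> - 1"
    unfolding * using * by (simp add: algebra_simps power2_eq_square tri_sq_def)
  finally show "\<beta> * \<beta> = 2 * \<alpha> - 1" .
qed

text \<open>Reduces products to the basis \<open>1\<close>, \<open>\<alpha>\<close>,
  \<open>\<beta>\<close>; the versions with \<open>c\<close> catch right-nested products with a
  further factor.\<close>

lemma tri_mult_simps:
  "\<alpha> * \<beta> = 1 - \<alpha> - \<beta>" "\<beta> * \<alpha> = 1 - \<alpha> - \<beta>" "\<beta> * \<beta> = 2 * \<alpha> - 1"
  "\<alpha> * (\<beta> * c) = c - \<alpha> * c - \<beta> * c" "\<beta> * (\<alpha> * c) = c - \<alpha> * c - \<beta> * c"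
  "\<beta> * (\<beta> * c) = 2 * \<alpha> * c - c"
  using tri_mult(1) arg_cong[OF tri_mult(1), of "\<lambda>x. x * c"] tri_mult(2) arg_cong[OF tri_mult(2), of "\<lambda>x. x * c"]
  by (simp_all add: algebra_simps)

section \<open>The Arnoux--Yoccoz interval exchange and its deformation\<close>

abbreviation unit_interval :: "real set" ("\<I>") where "\<I> \<equiv> {0..<1}"

text \<open>
  The origin is the midpoint of the arc of length \<open>\<alpha>\<^sup>3 = 1 - \<alpha> - \<beta>\<close>, so it is the end points of the arcs,
  rather than their midpoints, that move with \<open>t\<close>. The third cut is the preimage of the origin.
\<close>

definition cuts :: "real \<Rightarrow> real list" where
  "cuts t = [0, (1 - \<alpha> - \<beta>) / 2 - t, (1 - \<alpha>) / 2, (1 - \<beta>) / 2, (1 + \<alpha> - \<beta>) / 2 - t, (1 + \<alpha>) / 2,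
     (1 + \<alpha> + \<beta>) / 2 - t, 1]"

text \<open>Each entry is \<open>1 / 2\<close> plus or minus half the length of an arc, modulo
  \<open>1\<close>. Entries 1 and 2 belong to one half arc, cut at the preimage of the
  origin.\<close>

definition shifts :: "real list" where
  "shifts = [(\<alpha> + \<beta>) / 2, (1 + \<alpha>) / 2, (\<alpha> - 1) / 2, (1 - \<alpha>) / 2, (\<beta> - 1) / 2, - (1 + \<beta>) / 2, - (\<alpha> + \<beta>) / 2]"

definition piece :: "real \<Rightarrow> real \<Rightarrow> nat" where
  "piece t x = (LEAST i. x < cuts t ! Suc i)"

text \<open>Being the identity elsewhere matches the default value of
  \<open>interval_exchange\<close>, so the two maps will be equal as functions.\<close>

definition exch :: "real \<Rightarrow> real \<Rightarrow> real" where
  "exch t x = (if 0 \<le> x \<and> x < 1 then x + shifts ! piece t x else x)"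

text \<open>At \<open>t = \<alpha>\<^sup>3/2\<close> the first interval degenerates.\<close>

definition tmax :: real where "tmax = (1 - \<alpha> - \<beta>) / 2"

lemma less_7_cases:
  assumes "(i::nat) < 7"
  obtains "i = 0" | "i = 1" | "i = 2" | "i = 3" | "i = 4" | "i = 5" | "i = 6"
  using assms by linarith

lemma cuts_less_Suc:
  assumes "- tmax < t" "t < tmax" "i < 7"
  shows "cuts t ! i < cuts t ! Suc i"
  using assms(3) assms(1,2)[unfolded tmax_def] tri_bounds
  by (elim less_7_cases; simp add: cuts_def field_simps; linarith)

lemma cuts_mono:
  assumes "- tmax < t" "t < tmax" "i \<le> j" "j \<le> 7"
  shows "cuts t ! i \<le> cuts t ! j"
  using assms(3,4)
proof (induction rule: dec_induct)
  case (step n)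
  then show ?case using cuts_less_Suc[OF assms(1,2), of n] by simp
qed simp

lemma piece_eqI:
  assumes "- tmax < t" "t < tmax" "i < 7" "cuts t ! i \<le> x" "x < cuts t ! Suc i"
  shows "piece t x = i"
  unfolding piece_def
proof (rule Least_equality)
  fix j assume "x < cuts t ! Suc j"
  then show "i \<le> j"
    using cuts_mono[OF assms(1,2), of "Suc j" i] assms by (cases "i \<le> j") auto
qed fact

lemma piece_cases:
  assumes "0 \<le> x" "x < 1"
  shows "piece t x < 7" "cuts t ! piece t x \<le> x" "x < cuts t ! Suc (piece t x)"
proof -
  have 7: "x < cuts t ! Suc 6" using assms by (simp add: cuts_def)
  show "x < cuts t ! Suc (piece t x)"
    unfolding piece_def by (rule LeastI) (rule 7)
  have "piece t x \<le> 6"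
    unfolding piece_def by (rule Least_le) (rule 7)
  then show "piece t x < 7" by simp
  show "cuts t ! piece t x \<le> x"
  proof (cases "piece t x")
    case 0
    then show ?thesis using assms by (simp add: cuts_def)
  next
    case (Suc j)
    then show ?thesis
      using not_less_Least[of j "\<lambda>i. x < cuts t ! Suc i"] unfolding piece_def by (simp add: not_less)
  qed
qed

lemma cuts_bounds:
  assumes "- tmax < t" "t < tmax" "i \<le> 7"
  shows "0 \<le> cuts t ! i" "cuts t ! i \<le> 1"
  using cuts_mono[OF assms(1,2), of 0 i] cuts_mono[OF assms(1,2,3)] assms(3) by (auto simp: cuts_def)

lemma exch_eqI:
  assumes "- tmax < t" "t < tmax" "i < 7" "cuts t ! i \<le> x" "x < cuts t ! Suc i"
  shows "exch t x = x + shifts ! i"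
  using piece_eqI[OF assms] cuts_bounds(1)[OF assms(1,2), of i] cuts_bounds(2)[OF assms(1,2), of "Suc i"]
    assms(3-) by (simp add: exch_def)

section \<open>Images of the pieces, range and injectivity\<close>

definition perm :: "nat list" where "perm = [3, 6, 0, 5, 2, 1, 4]"

definition image_cuts :: "real \<Rightarrow> real list" where
  "image_cuts t = [0, (\<alpha> - \<beta>) / 2, \<alpha> / 2 - t, (\<alpha> + \<beta>) / 2, 1 / 2 - t, 1 - (\<alpha> + \<beta>) / 2, 1 - \<beta> / 2 - t, 1]"

lemma perm_less_7: "i < 7 \<Longrightarrow> perm ! i < 7"
  by (elim less_7_cases) (simp_all add: perm_def)

lemma perm_inj: "i < 7 \<Longrightarrow> j < 7 \<Longrightarrow> perm ! i = perm ! j \<Longrightarrow> i = j"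
  by (subst (asm) nth_eq_iff_index_eq) (simp_all add: perm_def)

lemma image_cuts_mono:
  assumes "- tmax < t" "t < tmax" "m \<le> n" "n \<le> 7"
  shows "image_cuts t ! m \<le> image_cuts t ! n"
  using assms(3,4)
proof (induction rule: dec_induct)
  case (step n)
  have "n < 7" using step by simp
  then have "image_cuts t ! n \<le> image_cuts t ! Suc n"
    using assms(1,2)[unfolded tmax_def] tri_bounds
    by (elim less_7_cases; simp add: image_cuts_def field_simps; linarith)
  then show ?case using step by simp
qed simp

lemma image_cuts_perm:
  assumes "i < 7"
  shows "image_cuts t ! (perm ! i) = cuts t ! i + shifts ! i"
    and "image_cuts t ! Suc (perm ! i) = cuts t ! Suc i + shifts ! i"
  using assms
  by (elim less_7_cases; simp add: perm_def image_cuts_def cuts_def shifts_def field_simps)+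

lemma exch_image:
  assumes "0 \<le> x" "x < 1"
  shows "image_cuts t ! (perm ! piece t x) \<le> exch t x" "exch t x < image_cuts t ! Suc (perm ! piece t x)"
  using assms piece_cases[OF assms, of t] image_cuts_perm[of "piece t x" t] by (auto simp: exch_def)

lemma exch_range:
  assumes t: "- tmax < t" "t < tmax" and x: "0 \<le> x" "x < 1"
  shows "0 \<le> exch t x" "exch t x < 1"
  using exch_image[OF x, of t] perm_less_7[OF piece_cases(1)[OF x, of t]]
    image_cuts_mono[OF t, of 0 "perm ! piece t x"] image_cuts_mono[OF t, of "Suc (perm ! piece t x)" 7]
  by (auto simp: image_cuts_def[of t])

text \<open>Different pieces land in different gaps of the image partition.\<close>

lemma inj_on_exch:
  assumes t: "- tmax < t" "t < tmax"
  shows "inj_on (exch t) {0..<1}"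
proof (rule inj_onI)
  fix x y assume xy: "x \<in> {0..<1}" "y \<in> {0..<1}" and eq: "exch t x = exch t y"
  have less: "exch t a < exch t b"
    if "a \<in> {0..<1}" "b \<in> {0..<1}" "perm ! piece t a < perm ! piece t b" for a b
    using that exch_image[of a t] exch_image[of b t] piece_cases(1)[of b t] perm_less_7[of "piece t b"]
      image_cuts_mono[OF t, of "Suc (perm ! piece t a)" "perm ! piece t b"] by force
  have "perm ! piece t x = perm ! piece t y"
    using less[OF xy] less[OF xy(2,1)] eq by force
  then have "piece t x = piece t y"
    using perm_inj piece_cases(1) xy by simp
  then show "x = y" using xy eq by (simp add: exch_def)
qed

text \<open>Phrased with translations instead of \<open>exch\<close>, so that an explicit list
  unfolds into linear inequalities; \<open>itineraryD\<close> carries the result over to the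
  map.\<close>

fun itinerary :: "real \<Rightarrow> nat list \<Rightarrow> real \<Rightarrow> bool" where
  "itinerary t [] x \<longleftrightarrow> True"
| "itinerary t (i # is) x \<longleftrightarrow>
     cuts t ! i \<le> x \<and> x < cuts t ! Suc i \<and> itinerary t is (x + shifts ! i)"

abbreviation disp :: "nat list \<Rightarrow> real" where "disp is \<equiv> sum_list (map ((!) shifts) is)"

lemma itineraryD:
  assumes "- tmax < t" "t < tmax" "set is \<subseteq> {..<7}" "itinerary t is x" "k \<le> length is"
  shows "(exch t ^^ k) x = x + disp (take k is)"
    and "k < length is \<Longrightarrow> piece t ((exch t ^^ k) x) = is ! k"
  using assms(3-)
proof (induction "is" arbitrary: x k)
  case (Cons i "is")
  { case 1
    then show ?case using exch_eqI[OF assms(1,2), of i x] Cons.IH(1)[of "x + shifts ! i" "k - 1"]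
      by (cases k) (auto simp: funpow_swap1 simp del: funpow.simps simp: funpow_Suc_right)
  next
    case 2
    then show ?case using exch_eqI[OF assms(1,2), of i x] piece_eqI[OF assms(1,2), of i x]
        Cons.IH(2)[of "k - 1" "x + shifts ! i" ]
      by (cases k) (auto simp: funpow_swap1 simp del: funpow.simps simp: funpow_Suc_right) }
qed auto

text \<open>Left end of the return interval, of length \<open>\<beta>\<close>; it does not move with
  the parameter.\<close>

definition base :: real where "base = (\<alpha> - \<beta>) / 2"

text \<open>
  The \<open>i\<close>-th list is the itinerary, until its first return, of the \<open>i\<close>-th piece of the scaled copy of the
  exchange.
\<close>

definition returns :: "nat list list" where
  "returns = [[1,5],[1,6,3,4],[1,6,3,5],[2,0,3,4],[2,1,5],[3,3,5],[3,4]]"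

text \<open>Makes the cuts of the scaled copy linear in \<open>\<alpha>\<close>,
  \<open>\<beta>\<close> and \<open>\<beta> * s\<close>.\<close>

lemma scaled_cuts:
  assumes "i < 8"
  shows "\<beta> * cuts s ! i = [0, (2 * \<beta> - \<alpha>) / 2 - \<beta> * s, (2 * \<beta> - 1 + \<alpha>) / 2, (\<beta> - 2 * \<alpha> + 1) / 2,
     (2 - 3 * \<alpha>) / 2 - \<beta> * s, (1 - \<alpha>) / 2, \<alpha> / 2 - \<beta> * s, \<beta>] ! i"
proof -
  have "i \<in> {0,1,2,3,4,5,6,7}" using assms by auto
  then show ?thesis
    by (elim insertE emptyE; simp add: cuts_def field_simps tri_mult_simps)
qed

text \<open>The arithmetic core of self-similarity: returns to the copy move points by the scaled
  translations, whatever the parameter.\<close>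

lemma scaled_shifts:
  assumes "i < 7"
  shows "\<beta> * shifts ! i = disp (returns ! i)"
  using assms
  by (elim less_7_cases; simp add: shifts_def returns_def field_simps tri_mult_simps)

text \<open>With \<open>\<beta> * x\<close> and \<open>\<beta> * s\<close> as single unknowns
  \<open>y\<close> and \<open>t\<close>, every visit is a linear inequality.\<close>

lemma itinerary_returns:
  assumes s: "0 \<le> s" "s < tmax" and i: "i < 7" and x: "cuts s ! i \<le> x" "x < cuts s ! Suc i"
  shows "itinerary (\<beta> * s) (returns ! i) (base + \<beta> * x)"
proof -
  define y t where "y = \<beta> * x" and "t = \<beta> * s"
  have "\<beta> * cuts s ! i \<le> y" "y < \<beta> * cuts s ! Suc i"
    using x tri_bounds by (simp_all add: y_def)
  note y = this[unfolded scaled_cuts[OF less_trans[OF i], simplified] scaled_cuts[of "Suc i", simplified, OF i] t_def[symmetric]]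
  have "0 \<le> t" "t < \<beta> * tmax" using s tri_pos by (simp_all add: t_def)
  moreover have "\<beta> * tmax = (2 * \<beta> - \<alpha>) / 2" by (simp add: tmax_def field_simps tri_mult_simps)
  ultimately have t: "0 \<le> t" "t < (2 * \<beta> - \<alpha>) / 2" by simp_all
  show ?thesis
    using i y t tri_bounds unfolding y_def[symmetric] t_def[symmetric]
    by (elim less_7_cases; simp add: returns_def base_def shifts_def cuts_def field_simps; intro conjI; linarith)
qed

section \<open>Periodicity\<close>

text \<open>
  Along an orbit the position is tracked as \<open>x + (a + b\<alpha> + c\<beta>)/2\<close> with numerals \<open>a\<close>, \<open>b\<close>, \<open>c\<close>, so that each visit
  becomes a small linear inequality in \<open>x\<close>, \<open>t\<close>, \<open>\<alpha>\<close>, \<open>\<beta>\<close>.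
\<close>

definition offset :: "real \<Rightarrow> real \<Rightarrow> real \<Rightarrow> real" where
  "offset a b c = a / 2 + b * \<alpha> / 2 + c * \<beta> / 2"

text \<open>The tail of a loop: the orbit of \<open>x\<close> has already moved by the offset, and
  \<open>is\<close> leads it back to \<open>x\<close>.\<close>

definition closes_up :: "real \<Rightarrow> nat list \<Rightarrow> real \<Rightarrow> real \<Rightarrow> real \<Rightarrow> real \<Rightarrow> bool" where
  "closes_up t is a b c x \<longleftrightarrow> set is \<subseteq> {..<7} \<and> itinerary t is (x + offset a b c) \<and> offset a b c + disp is = 0"

definition visits :: "real \<Rightarrow> nat \<Rightarrow> real \<Rightarrow> bool" where
  "visits t i x \<longleftrightarrow> cuts t ! i \<le> x \<and> x < cuts t ! Suc i"

lemma closes_up_Cons: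
  assumes "i < 7" "offset a b c + shifts ! i = offset a' b' c'"
  shows "closes_up t (i # is) a b c x \<longleftrightarrow> visits t i (x + offset a b c) \<and> closes_up t is a' b' c' x"
  using assms by (auto simp: closes_up_def visits_def add.assoc simp flip: assms(2))

text \<open>Consuming one letter only changes the numerals, and the empty list demands that they are
  back at zero. \<open>Suc 0\<close> is the form to which the simplifier brings
  \<open>1\<close>.\<close>

lemma closes_up_simps:
  "closes_up t [] 0 0 0 x"
  "closes_up t (0 # is) a b c x \<longleftrightarrow> visits t 0 (x + offset a b c) \<and> closes_up t is a (b + 1) (c + 1) x"
  "closes_up t (Suc 0 # is) a b c x \<longleftrightarrow> visits t (Suc 0) (x + offset a b c) \<and> closes_up t is (a + 1) (b + 1) c x"
  "closes_up t (2 # is) a b c x \<longleftrightarrow> visits t 2 (x + offset a b c) \<and> closes_up t is (a - 1) (b + 1) c x"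
  "closes_up t (3 # is) a b c x \<longleftrightarrow> visits t 3 (x + offset a b c) \<and> closes_up t is (a + 1) (b - 1) c x"
  "closes_up t (4 # is) a b c x \<longleftrightarrow> visits t 4 (x + offset a b c) \<and> closes_up t is (a - 1) b (c + 1) x"
  "closes_up t (5 # is) a b c x \<longleftrightarrow> visits t 5 (x + offset a b c) \<and> closes_up t is (a - 1) b (c - 1) x"
  "closes_up t (6 # is) a b c x \<longleftrightarrow> visits t 6 (x + offset a b c) \<and> closes_up t is a (b - 1) (c - 1) x"
  by (simp add: closes_up_def offset_def)
    (rule closes_up_Cons; simp add: offset_def shifts_def add_divide_distrib diff_divide_distrib distrib_right left_diff_distrib)+

lemma visits_simps:
  "visits t 0 x \<longleftrightarrow> 0 \<le> x \<and> x < 1 / 2 - \<alpha> / 2 - \<beta> / 2 - t"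
  "visits t (Suc 0) x \<longleftrightarrow> 1 / 2 - \<alpha> / 2 - \<beta> / 2 - t \<le> x \<and> x < 1 / 2 - \<alpha> / 2"
  "visits t 2 x \<longleftrightarrow> 1 / 2 - \<alpha> / 2 \<le> x \<and> x < 1 / 2 - \<beta> / 2"
  "visits t 3 x \<longleftrightarrow> 1 / 2 - \<beta> / 2 \<le> x \<and> x < 1 / 2 + \<alpha> / 2 - \<beta> / 2 - t"
  "visits t 4 x \<longleftrightarrow> 1 / 2 + \<alpha> / 2 - \<beta> / 2 - t \<le> x \<and> x < 1 / 2 + \<alpha> / 2"
  "visits t 5 x \<longleftrightarrow> 1 / 2 + \<alpha> / 2 \<le> x \<and> x < 1 / 2 + \<alpha> / 2 + \<beta> / 2 - t"
  "visits t 6 x \<longleftrightarrow> 1 / 2 + \<alpha> / 2 + \<beta> / 2 - t \<le> x \<and> x < 1"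
  by (simp_all add: visits_def cuts_def add_divide_distrib diff_divide_distrib)

definition loop :: "real \<Rightarrow> real \<Rightarrow> bool" where
  "loop t x \<longleftrightarrow> (\<exists>is. is \<noteq> [] \<and> set is \<subseteq> {..<7} \<and> itinerary t is x \<and> disp is = 0)"

lemma loopI: "closes_up t (i # is) 0 0 0 x \<Longrightarrow> loop t x"
  unfolding loop_def closes_up_def by (rule exI[of _ "i # is"]) (simp add: offset_def)

text \<open>
  The case boundaries in the next two lemmas are the points whose orbit runs into a cut.
\<close>

lemma loop_large:
  assumes t: "\<alpha> - 1 / 2 \<le> t" "t < tmax" and x: "base \<le> x" "x < base + \<beta>"
  shows "loop t x"
proof -
  note bounds = t[unfolded tmax_def add_divide_distrib diff_divide_distrib]
    x[unfolded base_def add_divide_distrib diff_divide_distrib] tri_bounds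
  consider "x < 1 / 2 - \<beta> - t"
    | "1 / 2 - \<beta> - t \<le> x" "x < \<alpha> + \<beta> / 2 - 1 / 2"
    | "\<alpha> + \<beta> / 2 - 1 / 2 \<le> x" "x < \<alpha> / 2 - t"
    | "\<alpha> / 2 - t \<le> x" "x < 1 / 2 - \<alpha> / 2"
    | "1 / 2 - \<alpha> / 2 \<le> x" "x < 1 - \<alpha> - \<beta> / 2 - t"
    | "1 - \<alpha> - \<beta> / 2 - t \<le> x" "x < \<beta>"
    | "\<beta> \<le> x" "x < 1 / 2 + \<beta> / 2 - \<alpha> / 2 - t"
    | "1 / 2 + \<beta> / 2 - \<alpha> / 2 - t \<le> x" "x < 1 / 2 - \<beta> / 2"
    | "1 / 2 - \<beta> / 2 \<le> x" "x < 1 - \<alpha> / 2 - \<beta> - t"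
    | "1 - \<alpha> / 2 - \<beta> - t \<le> x"
    unfolding not_less[symmetric] by blast
  \<comment> \<open>Lists that are cyclic shifts of each other belong to one periodic band; there
    are four bands, of periods 17, 9, 3 and 5.\<close>
  then show ?thesis
  proof cases
    case 1
    note facts = this bounds
    have "closes_up t [1, 6, 3, 4, 3, 4, 2, 0, 3, 4, 2, 1, 5, 1, 6, 3, 5] 0 0 0 x"
      by (simp add: closes_up_simps; unfold visits_simps offset_def; intro conjI; use facts in linarith)
    then show ?thesis by (rule loopI)
  next
    case 2
    note facts = this bounds
    have "closes_up t [1, 6, 3, 4, 3, 4, 2, 1, 5] 0 0 0 x"
      by (simp add: closes_up_simps; unfold visits_simps offset_def; intro conjI; use facts in linarith)
    then show ?thesis by (rule loopI)
  next
    case 3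
    note facts = this bounds
    have "closes_up t [1, 6, 3, 5, 1, 6, 3, 4, 3, 4, 2, 0, 3, 4, 2, 1, 5] 0 0 0 x"
      by (simp add: closes_up_simps; unfold visits_simps offset_def; intro conjI; use facts in linarith)
    then show ?thesis by (rule loopI)
  next
    case 4
    note facts = this bounds
    have "closes_up t [1, 6, 4] 0 0 0 x"
      by (simp add: closes_up_simps; unfold visits_simps offset_def; intro conjI; use facts in linarith)
    then show ?thesis by (rule loopI)
  next
    case 5
    note facts = this bounds
    have "closes_up t [2, 0, 3, 4, 2, 1, 5, 1, 6, 3, 5, 1, 6, 3, 4, 3, 4] 0 0 0 x"
      by (simp add: closes_up_simps; unfold visits_simps offset_def; intro conjI; use facts in linarith)
    then show ?thesis by (rule loopI)
  next
    case 6
    note facts = this bounds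
    have "closes_up t [2, 1, 5, 1, 6, 3, 4, 3, 4] 0 0 0 x"
      by (simp add: closes_up_simps; unfold visits_simps offset_def; intro conjI; use facts in linarith)
    then show ?thesis by (rule loopI)
  next
    case 7
    note facts = this bounds
    have "closes_up t [2, 1, 5, 1, 6, 3, 5, 1, 6, 3, 4, 3, 4, 2, 0, 3, 4] 0 0 0 x"
      by (simp add: closes_up_simps; unfold visits_simps offset_def; intro conjI; use facts in linarith)
    then show ?thesis by (rule loopI)
  next
    case 8
    note facts = this bounds
    have "closes_up t [2, 1, 6, 3, 4] 0 0 0 x"
      by (simp add: closes_up_simps; unfold visits_simps offset_def; intro conjI; use facts in linarith)
    then show ?thesis by (rule loopI)
  next
    case 9
    note facts = this bounds
    have "closes_up t [3, 4, 2, 0, 3, 4, 2, 1, 5, 1, 6, 3, 5, 1, 6, 3, 4] 0 0 0 x"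
      by (simp add: closes_up_simps; unfold visits_simps offset_def; intro conjI; use facts in linarith)
    then show ?thesis by (rule loopI)
  next
    case 10
    note facts = this bounds
    have "closes_up t [3, 4, 2, 1, 5, 1, 6, 3, 4] 0 0 0 x"
      by (simp add: closes_up_simps; unfold visits_simps offset_def; intro conjI; use facts in linarith)
    then show ?thesis by (rule loopI)
  qed
qed

lemma loop_medium:
  assumes t: "\<beta> - \<alpha> / 2 \<le> t" "t < \<alpha> - 1 / 2" and x: "base \<le> x" "x < base + \<beta>"
  shows "loop t x"
proof -
  note bounds = t[unfolded tmax_def add_divide_distrib diff_divide_distrib]
    x[unfolded base_def add_divide_distrib diff_divide_distrib] tri_bounds
  consider "x < 3 * \<alpha> / 2 - 1 / 2 - \<beta> / 2 - t"
    | "3 * \<alpha> / 2 - 1 / 2 - \<beta> / 2 - t \<le> x" "x < 1 - \<alpha> - \<beta>"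
    | "1 - \<alpha> - \<beta> \<le> x" "x < 1 / 2 - \<beta> - t"
    | "1 / 2 - \<beta> - t \<le> x" "x < \<alpha> + \<beta> / 2 - 1 / 2"
    | "\<alpha> + \<beta> / 2 - 1 / 2 \<le> x" "x < 2 * \<alpha> + \<beta> / 2 - 1 - t"
    | "2 * \<alpha> + \<beta> / 2 - 1 - t \<le> x" "x < 1 / 2 - \<alpha> / 2"
    | "1 / 2 - \<alpha> / 2 \<le> x" "x < \<alpha> / 2 - t"
    | "\<alpha> / 2 - t \<le> x" "x < 3 / 2 - 2 * \<alpha> - \<beta> / 2"
    | "3 / 2 - 2 * \<alpha> - \<beta> / 2 \<le> x" "x < 1 - \<alpha> - \<beta> / 2 - t"
    | "1 - \<alpha> - \<beta> / 2 - t \<le> x" "x < \<beta>"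
    | "\<beta> \<le> x" "x < \<alpha> + \<beta> - 1 / 2 - t"
    | "\<alpha> + \<beta> - 1 / 2 - t \<le> x" "x < 1 + \<beta> / 2 - 3 * \<alpha> / 2"
    | "1 + \<beta> / 2 - 3 * \<alpha> / 2 \<le> x" "x < 1 / 2 + \<beta> / 2 - \<alpha> / 2 - t"
    | "1 / 2 + \<beta> / 2 - \<alpha> / 2 - t \<le> x" "x < 1 / 2 - \<beta> / 2"
    | "1 / 2 - \<beta> / 2 \<le> x" "x < \<alpha> - \<beta> / 2 - t"
    | "\<alpha> - \<beta> / 2 - t \<le> x" "x < 3 / 2 - 3 * \<alpha> / 2 - \<beta>"
    | "3 / 2 - 3 * \<alpha> / 2 - \<beta> \<le> x" "x < 1 - \<alpha> / 2 - \<beta> - t"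
    | "1 - \<alpha> / 2 - \<beta> - t \<le> x"
    unfolding not_less[symmetric] by blast
  \<comment> \<open>Again four periodic bands, now of periods 31, 17, 9 and 5.\<close>
  then show ?thesis
  proof cases
    case 1
    note facts = this bounds
    have "closes_up t [1, 6, 3, 4, 3, 3, 5, 1, 6, 3, 4, 3, 4, 2, 0, 3, 4, 2, 1, 5, 2, 0, 3, 4, 2, 1, 5, 1, 6, 3, 5] 0 0 0 x"
      by (simp add: closes_up_simps; unfold visits_simps offset_def; intro conjI; use facts in linarith)
    then show ?thesis by (rule loopI)
  next
    case 2
    note facts = this bounds
    have "closes_up t [1, 6, 3, 4, 3, 4, 2, 0, 3, 4, 2, 1, 5, 1, 6, 3, 5] 0 0 0 x"
      by (simp add: closes_up_simps; unfold visits_simps offset_def; intro conjI; use facts in linarith)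
    then show ?thesis by (rule loopI)
  next
    case 3
    note facts = this bounds
    have "closes_up t [1, 6, 3, 4, 3, 4, 2, 0, 3, 4, 2, 1, 5, 2, 0, 3, 4, 2, 1, 5, 1, 6, 3, 5, 1, 6, 3, 4, 3, 3, 5] 0 0 0 x"
      by (simp add: closes_up_simps; unfold visits_simps offset_def; intro conjI; use facts in linarith)
    then show ?thesis by (rule loopI)
  next
    case 4
    note facts = this bounds
    have "closes_up t [1, 6, 3, 4, 3, 4, 2, 1, 5] 0 0 0 x"
      by (simp add: closes_up_simps; unfold visits_simps offset_def; intro conjI; use facts in linarith)
    then show ?thesis by (rule loopI)
  next
    case 5
    note facts = this bounds
    have "closes_up t [1, 6, 3, 5, 1, 6, 3, 4, 3, 3, 5, 1, 6, 3, 4, 3, 4, 2, 0, 3, 4, 2, 1, 5, 2, 0, 3, 4, 2, 1, 5] 0 0 0 x"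
      by (simp add: closes_up_simps; unfold visits_simps offset_def; intro conjI; use facts in linarith)
    then show ?thesis by (rule loopI)
  next
    case 6
    note facts = this bounds
    have "closes_up t [1, 6, 3, 5, 1, 6, 3, 4, 3, 4, 2, 0, 3, 4, 2, 1, 5] 0 0 0 x"
      by (simp add: closes_up_simps; unfold visits_simps offset_def; intro conjI; use facts in linarith)
    then show ?thesis by (rule loopI)
  next
    case 7
    note facts = this bounds
    have "closes_up t [2, 0, 3, 4, 2, 1, 5, 1, 6, 3, 5, 1, 6, 3, 4, 3, 3, 5, 1, 6, 3, 4, 3, 4, 2, 0, 3, 4, 2, 1, 5] 0 0 0 x"
      by (simp add: closes_up_simps; unfold visits_simps offset_def; intro conjI; use facts in linarith)
    then show ?thesis by (rule loopI)
  next
    case 8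
    note facts = this bounds
    have "closes_up t [2, 0, 3, 4, 2, 1, 5, 1, 6, 3, 5, 1, 6, 3, 4, 3, 4] 0 0 0 x"
      by (simp add: closes_up_simps; unfold visits_simps offset_def; intro conjI; use facts in linarith)
    then show ?thesis by (rule loopI)
  next
    case 9
    note facts = this bounds
    have "closes_up t [2, 0, 3, 4, 2, 1, 5, 2, 0, 3, 4, 2, 1, 5, 1, 6, 3, 5, 1, 6, 3, 4, 3, 3, 5, 1, 6, 3, 4, 3, 4] 0 0 0 x"
      by (simp add: closes_up_simps; unfold visits_simps offset_def; intro conjI; use facts in linarith)
    then show ?thesis by (rule loopI)
  next
    case 10
    note facts = this bounds
    have "closes_up t [2, 1, 5, 1, 6, 3, 4, 3, 4] 0 0 0 x"
      by (simp add: closes_up_simps; unfold visits_simps offset_def; intro conjI; use facts in linarith)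
    then show ?thesis by (rule loopI)
  next
    case 11
    note facts = this bounds
    have "closes_up t [2, 1, 5, 1, 6, 3, 5, 1, 6, 3, 4, 3, 3, 5, 1, 6, 3, 4, 3, 4, 2, 0, 3, 4, 2, 1, 5, 2, 0, 3, 4] 0 0 0 x"
      by (simp add: closes_up_simps; unfold visits_simps offset_def; intro conjI; use facts in linarith)
    then show ?thesis by (rule loopI)
  next
    case 12
    note facts = this bounds
    have "closes_up t [2, 1, 5, 1, 6, 3, 5, 1, 6, 3, 4, 3, 4, 2, 0, 3, 4] 0 0 0 x"
      by (simp add: closes_up_simps; unfold visits_simps offset_def; intro conjI; use facts in linarith)
    then show ?thesis by (rule loopI)
  next
    case 13
    note facts = this bounds
    have "closes_up t [2, 1, 5, 2, 0, 3, 4, 2, 1, 5, 1, 6, 3, 5, 1, 6, 3, 4, 3, 3, 5, 1, 6, 3, 4, 3, 4, 2, 0, 3, 4] 0 0 0 x"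
      by (simp add: closes_up_simps; unfold visits_simps offset_def; intro conjI; use facts in linarith)
    then show ?thesis by (rule loopI)
  next
    case 14
    note facts = this bounds
    have "closes_up t [2, 1, 6, 3, 4] 0 0 0 x"
      by (simp add: closes_up_simps; unfold visits_simps offset_def; intro conjI; use facts in linarith)
    then show ?thesis by (rule loopI)
  next
    case 15
    note facts = this bounds
    have "closes_up t [3, 3, 5, 1, 6, 3, 4, 3, 4, 2, 0, 3, 4, 2, 1, 5, 2, 0, 3, 4, 2, 1, 5, 1, 6, 3, 5, 1, 6, 3, 4] 0 0 0 x"
      by (simp add: closes_up_simps; unfold visits_simps offset_def; intro conjI; use facts in linarith)
    then show ?thesis by (rule loopI)
  next
    case 16
    note facts = this bounds
    have "closes_up t [3, 4, 2, 0, 3, 4, 2, 1, 5, 1, 6, 3, 5, 1, 6, 3, 4] 0 0 0 x"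
      by (simp add: closes_up_simps; unfold visits_simps offset_def; intro conjI; use facts in linarith)
    then show ?thesis by (rule loopI)
  next
    case 17
    note facts = this bounds
    have "closes_up t [3, 4, 2, 0, 3, 4, 2, 1, 5, 2, 0, 3, 4, 2, 1, 5, 1, 6, 3, 5, 1, 6, 3, 4, 3, 3, 5, 1, 6, 3, 4] 0 0 0 x"
      by (simp add: closes_up_simps; unfold visits_simps offset_def; intro conjI; use facts in linarith)
    then show ?thesis by (rule loopI)
  next
    case 18
    note facts = this bounds
    have "closes_up t [3, 4, 2, 1, 5, 1, 6, 3, 4] 0 0 0 x"
      by (simp add: closes_up_simps; unfold visits_simps offset_def; intro conjI; use facts in linarith)
    then show ?thesis by (rule loopI)
  qed
qed

section \<open>Every orbit meets the return interval\<close>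

lemma tmax_bounds: "1 / 20 < tmax" "0 < tmax" "tmax < 1 / 10"
  using tri_bounds by (simp_all add: tmax_def)

lemma exch_visits:
  assumes "- tmax < t" "t < tmax" "i < 7" "visits t i x"
  shows "exch t x = x + shifts ! i"
  using exch_eqI[OF assms(1-3)] assms(4) by (simp add: visits_def)

lemma visits_piece:
  assumes "x \<in> \<I>"
  shows "piece t x < 7" "visits t (piece t x) x"
  using piece_cases[of x t] assms by (auto simp: visits_def)

lemma exch_in: "- tmax < t \<Longrightarrow> t < tmax \<Longrightarrow> x \<in> \<I> \<Longrightarrow> exch t x \<in> \<I>"
  using exch_range by auto

lemma periodic_if_loop:
  assumes "- tmax < t" "t < tmax" "loop t x"
  shows "\<exists>n>0. (exch t ^^ n) x = x"
  using assms(3) itineraryD(1)[OF assms(1,2)] unfolding loop_def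
  by (metis add.right_neutral le_refl length_greater_0_conv take_all)

abbreviation return_interval :: "real set" where "return_interval \<equiv> {base..<base + \<beta>}"

lemma shifts_simps:
  "shifts ! 0 = \<alpha> / 2 + \<beta> / 2" "shifts ! Suc 0 = 1 / 2 + \<alpha> / 2" "shifts ! 2 = \<alpha> / 2 - 1 / 2"
  "shifts ! 3 = 1 / 2 - \<alpha> / 2" "shifts ! 4 = \<beta> / 2 - 1 / 2" "shifts ! 5 = - (1 / 2) - \<beta> / 2"
  "shifts ! 6 = - (\<alpha> / 2) - \<beta> / 2"
  by (simp_all add: shifts_def add_divide_distrib diff_divide_distrib)

lemma base_eq: "base = \<alpha> / 2 - \<beta> / 2"
  by (simp add: base_def diff_divide_distrib)

lemma tmax_eq: "tmax = 1 / 2 - \<alpha> / 2 - \<beta> / 2"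
  by (simp add: tmax_def diff_divide_distrib)

text \<open>Pieces 4 and 5 map into the return interval; the part of piece 3 to its right maps into
  pieces 4 and 5; pieces 0 and 6 map into that part or into pieces 4 and 5; the part of piece 1 to
  its left maps to its right. The facts below are numbered by these pieces.\<close>

lemma hits_return_interval:
  assumes t: "0 \<le> t" "t < tmax" and x: "x \<in> \<I>"
  shows "\<exists>k\<le>5. (exch t ^^ k) x \<in> return_interval"
proof -
  let ?hit = "\<lambda>n x. \<exists>k\<le>n. (exch t ^^ k) x \<in> return_interval"
  note bounds = t[unfolded tmax_eq] tri_bounds
  have t': "- tmax < t" using t tmax_bounds by linarith
  have step: "?hit (Suc n) y" if "i < 7" "visits t i y" "?hit n (y + shifts ! i)" for n i y
  proof -
    have "exch t y = y + shifts ! i" using exch_visits[OF t' t(2)] that by simp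
    then show ?thesis using that(3) by (metis Suc_le_mono comp_apply funpow_Suc_right)
  qed
  have mono: "?hit n y" if "?hit m y" "m \<le> n" for m n y using that by (meson order_trans)
  have 0: "?hit 0 y" if "base \<le> y" "y < base + \<beta>" for y using that by auto
  have 45: "?hit 1 y" if "1 / 2 + \<alpha> / 2 - \<beta> / 2 - t \<le> y" "y < 1 / 2 + \<alpha> / 2 + \<beta> / 2 - t" for y
  proof -
    show ?thesis
    proof (cases "y < 1 / 2 + \<alpha> / 2")
      case True
      have "?hit 0 (y + shifts ! 4)"
        by (rule 0; unfold shifts_simps base_eq; use True that bounds in linarith)
      with step[of 4 y 0] True that show ?thesis by (simp add: visits_simps)
    next
      case False
      have "?hit 0 (y + shifts ! 5)"
        by (rule 0; unfold shifts_simps base_eq; use False that bounds in linarith)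
      with step[of 5 y 0] False that show ?thesis by (simp add: visits_simps)
    qed
  qed
  have 3: "?hit 2 y" if "\<alpha> / 2 + \<beta> / 2 \<le> y" "y < 1 / 2 + \<alpha> / 2 + \<beta> / 2 - t" for y
  proof (cases "y < 1 / 2 + \<alpha> / 2 - \<beta> / 2 - t")
    case True
    have "visits t 3 y" unfolding visits_simps using that True bounds by linarith
    moreover have "?hit 1 (y + shifts ! 3)"
      by (rule 45; unfold shifts_simps; use True that bounds in linarith)
    ultimately show ?thesis using step[of 3 y 1] by (simp add: numeral_2_eq_2)
  next
    case False
    then have "?hit 1 y" using that by (intro 45) auto
    then show ?thesis by (rule mono) simp
  qed
  have 06: "?hit 3 y" if "visits t 0 y \<or> visits t 6 y" for y
    using that
  proof
    assume v: "visits t 0 y"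
    have "?hit 2 (y + shifts ! 0)"
      by (rule 3; unfold shifts_simps; use v[unfolded visits_simps] bounds in linarith)
    with v step[of 0 y 2] show ?thesis by (simp add: numeral_3_eq_3)
  next
    assume v: "visits t 6 y"
    have "?hit 2 (y + shifts ! 6)"
      by (rule 3; unfold shifts_simps; use v[unfolded visits_simps] bounds in linarith)
    with v step[of 6 y 2] show ?thesis by (simp add: numeral_3_eq_3)
  qed
  have high: "?hit 3 y" if "\<alpha> / 2 + \<beta> / 2 \<le> y" "y < 1" for y
  proof (cases "y < 1 / 2 + \<alpha> / 2 + \<beta> / 2 - t")
    case True
    show ?thesis by (rule mono[OF 3]) (use that True in simp_all)
  next
    case False
    then show ?thesis using that by (intro 06) (simp add: visits_simps)
  qed
  have "?hit 4 x" if "\<not> visits t 0 x" "x < base"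
  proof -
    have v: "visits t 1 x"
      using that x bounds unfolding One_nat_def visits_simps base_eq atLeastLessThan_iff by linarith
    have "?hit 3 (x + shifts ! 1)"
      unfolding One_nat_def
      by (rule high; unfold shifts_simps; use v[unfolded One_nat_def visits_simps] that(2)[unfolded base_eq] bounds in linarith)
    with v step[of 1 x 3] show ?thesis by (simp add: eval_nat_numeral)
  qed
  moreover have "?hit 3 x" if "base + \<beta> \<le> x"
    by (rule high) (use that x in \<open>auto simp: base_eq\<close>)
  ultimately show ?thesis
    using 0[of x] 06[of x] mono[of _ x 5] by (metis Suc_le_mono linorder_not_le numeral_le_iff semiring_norm(68,69,71,72,73,76,77,78) zero_le le0)
qed

section \<open>Renormalization of the parameter\<close>

definition rescale :: "real \<Rightarrow> real" where "rescale x = base + \<beta> * x"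

definition return_time :: "real \<Rightarrow> real \<Rightarrow> nat" where "return_time s x = length (returns ! piece s x)"

lemma returns_bounds: "i < 7 \<Longrightarrow> set (returns ! i) \<subseteq> {..<7} \<and> 0 < length (returns ! i) \<and> length (returns ! i) \<le> 4"
  by (elim less_7_cases) (simp_all add: returns_def)

lemma rescale_in: "x \<in> \<I> \<longleftrightarrow> rescale x \<in> return_interval"
  using tri_pos by (simp add: rescale_def zero_le_mult_iff)

lemma return_interval_subset: "return_interval \<subseteq> \<I>"
  using tri_bounds by (auto simp: base_eq)

lemma rescale_surj: "y \<in> return_interval \<Longrightarrow> \<exists>x\<in>\<I>. y = rescale x"
  using tri_pos by (intro bexI[of _ "(y - base) / \<beta>"]) (auto simp: rescale_def field_simps)

lemma scaled_range:
  assumes "0 \<le> s" "s < tmax"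
  shows "0 \<le> \<beta> * s" "\<beta> * s < tmax" "- tmax < \<beta> * s"
proof -
  have "\<beta> * s \<le> 1 * s" using assms tri_pos by (intro mult_right_mono) auto
  moreover show "0 \<le> \<beta> * s" using assms tri_pos by simp
  ultimately show "\<beta> * s < tmax" "- tmax < \<beta> * s" using assms tmax_bounds by linarith+
qed

lemma return_itinerary:
  assumes s: "0 \<le> s" "s < tmax" and x: "x \<in> \<I>"
  shows "itinerary (\<beta> * s) (returns ! piece s x) (rescale x)"
  unfolding rescale_def
  by (rule itinerary_returns[OF s]) (use visits_piece[OF x, of s] in \<open>auto simp: visits_def\<close>)

lemma return_orbit:
  assumes s: "0 \<le> s" "s < tmax" and x: "x \<in> \<I>" and k: "k \<le> return_time s x"
  shows "(exch (\<beta> * s) ^^ k) (rescale x) = rescale x + disp (take k (returns ! piece s x))"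
    and "k < return_time s x \<Longrightarrow> piece (\<beta> * s) ((exch (\<beta> * s) ^^ k) (rescale x)) = returns ! piece s x ! k"
proof -
  note * = itineraryD[OF scaled_range(3,2)[OF s] _ return_itinerary[OF s x], of k]
  have r: "set (returns ! piece s x) \<subseteq> {..<7}" using returns_bounds[OF visits_piece(1)[OF x]] by simp
  show "(exch (\<beta> * s) ^^ k) (rescale x) = rescale x + disp (take k (returns ! piece s x))"
    using *(1)[OF r] k by (simp add: return_time_def)
  show "k < return_time s x \<Longrightarrow> piece (\<beta> * s) ((exch (\<beta> * s) ^^ k) (rescale x)) = returns ! piece s x ! k"
    using *(2)[OF r] k by (simp add: return_time_def)
qed

lemma return_map:
  assumes s: "0 \<le> s" "s < tmax" and x: "x \<in> \<I>"
  shows "(exch (\<beta> * s) ^^ return_time s x) (rescale x) = rescale (exch s x)"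
proof -
  have "rescale (exch s x) = rescale x + \<beta> * shifts ! piece s x"
    using x by (simp add: rescale_def exch_def distrib_left)
  also have "\<beta> * shifts ! piece s x = disp (returns ! piece s x)"
    by (rule scaled_shifts[OF visits_piece(1)[OF x]])
  finally show ?thesis
    using return_orbit(1)[OF s x le_refl] by (simp add: return_time_def)
qed

text \<open>All orbits enter the scaled copy, where a period of \<open>exch s\<close> becomes a
  period of the larger map, namely the sum of the return times along it.\<close>

lemma periodic_exch_scaled:
  assumes s: "0 \<le> s" "s < tmax" and per: "periodic_on \<I> (exch s)"
  shows "periodic_on \<I> (exch (\<beta> * s))"
proof (rule periodic_on_if_hits)
  note r = scaled_range[OF s]
  show "inj_on (exch (\<beta> * s)) \<I>" by (rule inj_on_exch[OF r(3,2)])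
  show "exch (\<beta> * s) x \<in> \<I>" if "x \<in> \<I>" for x by (rule exch_in[OF r(3,2) that])
  show "\<exists>k. (exch (\<beta> * s) ^^ k) x \<in> return_interval" if "x \<in> \<I>" for x
    using hits_return_interval[OF r(1,2) that] by blast
  fix y assume "y \<in> return_interval"
  then obtain x where x: "x \<in> \<I>" "y = rescale x" using rescale_surj by blast
  have s': "- tmax < s" using s tmax_bounds by linarith
  obtain n where n: "n > 0" "(exch s ^^ n) x = x" using per x unfolding periodic_on_def by blast
  have "(exch (\<beta> * s) ^^ birkhoff_sum (exch s) (return_time s) n x) (rescale x) = rescale ((exch s ^^ n) x)"
    by (rule funpow_return[where S = \<I>]) (use exch_in[OF s' s(2)] return_map[OF s] x in auto)
  moreover have "0 < birkhoff_sum (exch s) (return_time s) n x"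
  proof -
    have "0 < birkhoff_sum (exch s) (return_time s) (Suc m) x" for m
      using returns_bounds[OF visits_piece(1)[OF x(1)], of s]
      by (induction m) (simp_all add: birkhoff_sum_Suc return_time_def)
    then show ?thesis using n(1) by (metis Suc_pred)
  qed
  ultimately show "\<exists>n>0. (exch (\<beta> * s) ^^ n) y = y" using n x by auto
qed

text \<open>The parameters form a fundamental domain of multiplication by \<open>\<beta>\<close>; at
  \<open>\<alpha> - 1 / 2\<close> the lists of loops change.\<close>

lemma periodic_exch_base:
  assumes t: "\<beta> * tmax \<le> t" "t < tmax"
  shows "periodic_on \<I> (exch t)"
proof (rule periodic_on_if_hits)
  have t0: "0 \<le> t" using t tmax_bounds tri_pos by (meson less_imp_le mult_nonneg_nonneg order_trans)
  then have t': "- tmax < t" using tmax_bounds by linarith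
  show "inj_on (exch t) \<I>" by (rule inj_on_exch[OF t' t(2)])
  show "exch t x \<in> \<I>" if "x \<in> \<I>" for x by (rule exch_in[OF t' t(2) that])
  show "\<exists>k. (exch t ^^ k) x \<in> return_interval" if "x \<in> \<I>" for x
    using hits_return_interval[OF t0 t(2) that] by blast
  have "\<beta> * tmax = \<beta> - \<alpha> / 2" by (simp add: tmax_def field_simps tri_mult_simps)
  then show "\<exists>n>0. (exch t ^^ n) y = y" if "y \<in> return_interval" for y
    using that t loop_large[of t y] loop_medium[of t y]
    by (intro periodic_if_loop[OF t' t(2)]) (cases "\<alpha> - 1 / 2 \<le> t"; simp)
qed

text \<open>As \<open>\<beta> ^ n * tmax\<close> tends to \<open>0\<close>, finitely many divisions
  by \<open>\<beta>\<close> bring \<open>t\<close> into the fundamental domain. For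
  \<open>n = 0\<close> the assumptions contradict each other.\<close>

lemma periodic_exch_pos:
  assumes t: "0 < t" "t < tmax"
  shows "periodic_on \<I> (exch t)"
proof -
  have "(\<lambda>n. \<beta> ^ n * tmax) \<longlonglongrightarrow> 0 * tmax"
    using tri_pos by (intro tendsto_intros LIMSEQ_power_zero) auto
  then have "\<forall>\<^sub>F n in sequentially. \<beta> ^ n * tmax < t"
    using t by (intro order_tendstoD) auto
  then obtain n where "\<beta> ^ n * tmax \<le> t" by (auto simp: eventually_sequentially intro: less_imp_le)
  then show ?thesis using t
  proof (induction n arbitrary: t)
    case (Suc n)
    show ?case
    proof (cases "\<beta> * tmax \<le> t")
      case True
      then show ?thesis using periodic_exch_base Suc.prems by blast
    next
      case False
      have "periodic_on \<I> (exch (t / \<beta>))"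
        using Suc.prems False tri_pos by (intro Suc.IH) (auto simp: field_simps)
      then have "periodic_on \<I> (exch (\<beta> * (t / \<beta>)))"
        using Suc.prems False tri_pos by (intro periodic_exch_scaled) (auto simp: field_simps)
      then show ?thesis using tri_pos by simp
    qed
  qed simp
qed

section \<open>Negative parameters by time reversal\<close>

definition half_turn :: "real \<Rightarrow> real \<Rightarrow> real" where
  "half_turn t x = (if x < 1 / 2 + t then x + 1 / 2 - t else x - 1 / 2 - t)"

text \<open>On the circle this map is \<open>x + 1/2 - t\<close>; it conjugates \<open>T\<^bsub>-t\<^esub>\<close> to the inverse of \<open>T\<^sub>t\<close>.\<close>

lemma exch_reversal:
  assumes t: "- tmax < t" "t < tmax" and x: "x \<in> \<I>"
  shows "exch t (half_turn t (exch (- t) x)) = half_turn t x"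
proof -
  have t': "- tmax < - t" "- t < tmax" using t by auto
  have step: "exch t (half_turn t (exch (- t) x)) = half_turn t x"
    if "i < 7" "visits (- t) i x" "j < 7" "visits t j (half_turn t (x + shifts ! i))"
      "half_turn t (x + shifts ! i) + shifts ! j = half_turn t x" for i j
    using exch_visits[OF t' that(1,2)] exch_visits[OF t that(3,4)] that(5) by simp
  note bounds = t[unfolded tmax_eq] tri_bounds
  \<comment> \<open>Reversal swaps the halves of each arc, whose translations are opposite modulo
    \<open>1\<close>: pieces 0 and 6, 4 and 5, and 1 together with 2 against 3. Piece 3 is split
    where \<open>half_turn\<close> jumps.\<close>
  consider "visits (- t) 0 x" | "visits (- t) 1 x" | "visits (- t) 2 x" | "visits (- t) 3 x" "x < 1 / 2 + t"
    | "visits (- t) 3 x" "\<not> x < 1 / 2 + t" | "visits (- t) 4 x" | "visits (- t) 5 x" | "visits (- t) 6 x"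
    using visits_piece[OF x, of "- t"] less_7_cases by metis
  then show ?thesis
  proof cases
    case 1
    note f = 1[unfolded visits_simps] bounds
    have h: "x < 1 / 2 + t" "x + shifts ! 0 < 1 / 2 + t" unfolding shifts_simps using f by linarith+
    show ?thesis
      by (rule step[OF _ 1, of 6]; (simp only: half_turn_def h if_True)?; (unfold visits_simps shifts_simps)?; (intro conjI)?; (use f in linarith)?)
  next
    case 2
    note f = 2[unfolded One_nat_def visits_simps] bounds
    have h: "x < 1 / 2 + t" "\<not> x + shifts ! Suc 0 < 1 / 2 + t" unfolding shifts_simps using f by linarith+
    show ?thesis
      by (rule step[OF _ 2[unfolded One_nat_def], of 3]; (simp only: half_turn_def h if_True if_False)?; (unfold visits_simps shifts_simps)?; (intro conjI)?; (use f in linarith)?)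
  next
    case 3
    note f = 3[unfolded visits_simps] bounds
    have h: "x < 1 / 2 + t" "x + shifts ! 2 < 1 / 2 + t" unfolding shifts_simps using f by linarith+
    show ?thesis
      by (rule step[OF _ 3, of 3]; (simp only: half_turn_def h if_True)?; (unfold visits_simps shifts_simps)?; (intro conjI)?; (use f in linarith)?)
  next
    case 4
    note f = 4(1)[unfolded visits_simps] 4(2) bounds
    have h: "x < 1 / 2 + t" "\<not> x + shifts ! 3 < 1 / 2 + t" unfolding shifts_simps using f by linarith+
    show ?thesis
      by (rule step[OF _ 4(1), of "Suc 0"]; (simp only: half_turn_def h if_True if_False)?; (unfold visits_simps shifts_simps)?; (intro conjI)?; (use f in linarith)?)
  next
    case 5
    note f = 5(1)[unfolded visits_simps] 5(2) bounds
    have h: "\<not> x < 1 / 2 + t" "\<not> x + shifts ! 3 < 1 / 2 + t" unfolding shifts_simps using f by linarith+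
    show ?thesis
      by (rule step[OF _ 5(1), of 2]; (simp only: half_turn_def h if_False)?; (unfold visits_simps shifts_simps)?; (intro conjI)?; (use f in linarith)?)
  next
    case 6
    note f = 6[unfolded visits_simps] bounds
    have h: "\<not> x < 1 / 2 + t" "x + shifts ! 4 < 1 / 2 + t" unfolding shifts_simps using f by linarith+
    show ?thesis
      by (rule step[OF _ 6, of 5]; (simp only: half_turn_def h if_True if_False)?; (unfold visits_simps shifts_simps)?; (intro conjI)?; (use f in linarith)?)
  next
    case 7
    note f = 7[unfolded visits_simps] bounds
    have h: "\<not> x < 1 / 2 + t" "x + shifts ! 5 < 1 / 2 + t" unfolding shifts_simps using f by linarith+
    show ?thesis
      by (rule step[OF _ 7, of 4]; (simp only: half_turn_def h if_True if_False)?; (unfold visits_simps shifts_simps)?; (intro conjI)?; (use f in linarith)?)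
  next
    case 8
    note f = 8[unfolded visits_simps] bounds
    have h: "\<not> x < 1 / 2 + t" "\<not> x + shifts ! 6 < 1 / 2 + t" unfolding shifts_simps using f by linarith+
    show ?thesis
      by (rule step[OF _ 8, of 0]; (simp only: half_turn_def h if_False)?; (unfold visits_simps shifts_simps)?; (intro conjI)?; (use f in linarith)?)
  qed
qed

lemma periodic_exch:
  assumes "- tmax < t" "t < tmax" "t \<noteq> 0"
  shows "periodic_on \<I> (exch t)"
proof (cases "0 < t")
  case True
  then show ?thesis using periodic_exch_pos assms by blast
next
  case False
  define s where "s = - t"
  have s: "0 < s" "s < tmax" "- tmax < s" using False assms tmax_bounds by (auto simp: s_def)
  have "periodic_on \<I> (exch (- s))"
  proof (rule periodic_on_reversal[where T = "exch s" and f = "half_turn s"])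
    show "inj_on (half_turn s) \<I>"
      by (rule inj_onI) (auto simp: half_turn_def split: if_splits)
    show "half_turn s x \<in> \<I>" if "x \<in> \<I>" for x
      using that s tmax_bounds by (auto simp: half_turn_def)
    show "exch s x \<in> \<I>" if "x \<in> \<I>" for x by (rule exch_in[OF s(3,2) that])
    show "exch (- s) x \<in> \<I>" if "x \<in> \<I>" for x using exch_in[of "- s" x] that s by simp
    show "exch s (half_turn s (exch (- s) x)) = half_turn s x" if "x \<in> \<I>" for x
      by (rule exch_reversal[OF s(3,2) that])
  qed (rule inj_on_exch[OF s(3,2)] periodic_exch_pos[OF s(1,2)])+
  then show ?thesis by (simp add: s_def)
qed

section \<open>Self-similarity and unique ergodicity\<close>

text \<open>Needed for \<open>return_time\<close> to be the first return time. Return lists have at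
  most four entries, so only the times 1, 2 and 3 have to be excluded.\<close>

lemma no_early_return:
  assumes x: "x \<in> \<I>" and k: "0 < k" "k < return_time 0 x"
  shows "(exch 0 ^^ k) (rescale x) \<notin> return_interval"
proof
  assume "(exch 0 ^^ k) (rescale x) \<in> return_interval"
  moreover define i where "i = piece 0 x"
  moreover define y where "y = \<beta> * x"
  ultimately have J: "base \<le> base + y + disp (take k (returns ! i))" "base + y + disp (take k (returns ! i)) < base + \<beta>"
    using return_orbit(1)[of 0, OF _ _ x, of k] k tmax_bounds by (auto simp: rescale_def)
  have i: "i < 7" using visits_piece(1)[OF x] by (simp add: i_def)
  have "\<beta> * cuts 0 ! i \<le> y" "y < \<beta> * cuts 0 ! Suc i"
    using visits_piece(2)[OF x, of 0] tri_pos by (simp_all add: y_def i_def visits_def)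
  note y = this[unfolded scaled_cuts[OF less_trans[OF i], simplified] scaled_cuts[of "Suc i", simplified, OF i]]
  have "k < length (returns ! i)" using k by (simp add: return_time_def i_def)
  moreover have "k = 1 \<or> k = 2 \<or> k = 3" using calculation k(1) returns_bounds[OF i] by auto
  ultimately show False
    using i y J tri_bounds
    by (elim less_7_cases disjE; simp add: returns_def shifts_def field_simps; linarith)
qed

lemma first_return_exch:
  assumes x: "x \<in> \<I>"
  shows "first_return (exch 0) return_interval (rescale x) = rescale (exch 0 x)"
    and "0 < return_time 0 x" "(exch 0 ^^ return_time 0 x) (rescale x) = rescale (exch 0 x)" "exch 0 x \<in> \<I>"
proof -
  show ret: "(exch 0 ^^ return_time 0 x) (rescale x) = rescale (exch 0 x)"
    using return_map[of 0, OF _ _ x] tmax_bounds by simp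
  show pos: "0 < return_time 0 x"
    using returns_bounds[OF visits_piece(1)[OF x]] by (simp add: return_time_def)
  show "exch 0 x \<in> \<I>" using exch_in[of 0 x] x tmax_bounds by simp
  then have J: "rescale (exch 0 x) \<in> return_interval" by (simp only: rescale_in[symmetric])
  have "(LEAST n. 0 < n \<and> (exch 0 ^^ n) (rescale x) \<in> return_interval) = return_time 0 x"
  proof (rule Least_equality)
    show "0 < return_time 0 x \<and> (exch 0 ^^ return_time 0 x) (rescale x) \<in> return_interval"
      using pos ret J by (simp only: simp_thms)
    show "return_time 0 x \<le> n" if "0 < n \<and> (exch 0 ^^ n) (rescale x) \<in> return_interval" for n
      using no_early_return[OF x, of n] that by (meson not_le)
  qed
  then show "first_return (exch 0) return_interval (rescale x) = rescale (exch 0 x)"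
    using ret by (simp add: first_return_def)
qed

lemma self_similar_exch: "self_similar_on \<I> (exch 0)"
proof -
  have inv: "1 / \<beta> * rescale x + - base / \<beta> = x" for x
    using tri_pos by (simp add: rescale_def field_simps)
  have "0 \<notin> return_interval" using tri_bounds by (simp add: base_def)
  then have "return_interval \<noteq> \<I>" by (metis atLeastLessThan_iff order_refl zero_less_one)
  then have sub: "return_interval \<subset> \<I>" using return_interval_subset by blast
  have J: "return_interval = rescale ` \<I>" using rescale_in rescale_surj by blast
  have onto: "(\<lambda>x. 1 / \<beta> * x + - base / \<beta>) ` return_interval = \<I>"
    unfolding J image_image inv by simp
  have ret: "\<exists>n>0. (exch 0 ^^ n) y \<in> return_interval"
    and conj: "1 / \<beta> * first_return (exch 0) return_interval y + - base / \<beta> = exch 0 (1 / \<beta> * y + - base / \<beta>)"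
    if y: "y \<in> return_interval" for y
  proof -
    obtain x where x: "x \<in> \<I>" "y = rescale x" using rescale_surj[OF y] by blast
    note f = first_return_exch[OF x(1)]
    have "(exch 0 ^^ return_time 0 x) y \<in> return_interval" using f(3,4) x(2) rescale_in by metis
    then show "\<exists>n>0. (exch 0 ^^ n) y \<in> return_interval" using f(2) by blast
    show "1 / \<beta> * first_return (exch 0) return_interval y + - base / \<beta> = exch 0 (1 / \<beta> * y + - base / \<beta>)"
      unfolding x(2) f(1) inv ..
  qed
  show ?thesis
    unfolding self_similar_on_def
  proof (rule exI[of _ return_interval], intro conjI)
    show "\<exists>c b. 0 < c \<and> (\<lambda>x. c * x + b) ` return_interval = \<I> \<and>
        (\<forall>x\<in>return_interval. c * first_return (exch 0) return_interval x + b = exch 0 (c * x + b))"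
      by (rule exI[of _ "1 / \<beta>"], rule exI[of _ "- base / \<beta>"], intro conjI ballI onto conj)
        (use tri_pos in simp_all)
  qed (use sub ret in auto)
qed

section \<open>Invariance of Lebesgue measure\<close>

lemma exch_eq_indicator:
  assumes t: "- tmax < t" "t < tmax"
  shows "exch t x = x + (\<Sum>i<7. shifts ! i * indicator {cuts t ! i..<cuts t ! Suc i} x)"
proof (cases "x \<in> \<I>")
  case True
  have "shifts ! i * indicator {cuts t ! i..<cuts t ! Suc i} x = (if i = piece t x then shifts ! i else 0)"
    if "i < 7" for i
  proof (cases "i = piece t x")
    case i: True
    then have "x \<in> {cuts t ! i..<cuts t ! Suc i}" using visits_piece(2)[OF True, of t] by (simp add: visits_def)
    then show ?thesis using i by (simp only: indicator_simps mult_1_right if_True simp_thms)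
  next
    case False
    then have "x \<notin> {cuts t ! i..<cuts t ! Suc i}" using piece_eqI[OF t that, of x] by auto
    then show ?thesis using False by (simp only: indicator_simps mult_zero_right if_False simp_thms)
  qed
  then have "(\<Sum>i<7. shifts ! i * indicator {cuts t ! i..<cuts t ! Suc i} x) = (\<Sum>i<7. if i = piece t x then shifts ! i else 0)"
    by (intro sum.cong) simp_all
  then show ?thesis using True visits_piece(1)[OF True] by (simp add: exch_def)
next
  case False
  have "indicator {cuts t ! i..<cuts t ! Suc i} x = (0::real)" if "i < 7" for i
    using cuts_bounds(1)[OF t, of i] cuts_bounds(2)[OF t, of "Suc i"] False that by (auto simp: indicator_def)
  then show ?thesis using False by (auto simp: exch_def)
qed

lemma borel_measurable_exch:
  assumes "- tmax < t" "t < tmax"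
  shows "exch t \<in> borel_measurable borel"
proof -
  have "(\<lambda>x. x + (\<Sum>i<7. shifts ! i * indicator {cuts t ! i..<cuts t ! Suc i} x)) \<in> borel_measurable borel"
    by measurable
  then show ?thesis using exch_eq_indicator[OF assms] by (simp add: fun_eq_iff[symmetric] cong: measurable_cong)
qed

lemma image_cuts_cover:
  assumes y: "y \<in> \<I>"
  shows "\<exists>i<7. image_cuts t ! (perm ! i) \<le> y \<and> y < image_cuts t ! Suc (perm ! i)"
proof -
  define n where "n = (LEAST n. y < image_cuts t ! Suc n)"
  have 6: "y < image_cuts t ! Suc 6" using y by (simp add: image_cuts_def)
  have n: "y < image_cuts t ! Suc n" "n \<le> 6"
    unfolding n_def by (rule LeastI, rule 6) (rule Least_le, rule 6)
  have "image_cuts t ! n \<le> y"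
  proof (cases n)
    case 0
    then show ?thesis using y by (simp add: image_cuts_def)
  next
    case (Suc j)
    then show ?thesis using not_less_Least[of j "\<lambda>n. y < image_cuts t ! Suc n"] unfolding n_def by (simp add: not_less)
  qed
  moreover have "\<exists>i<7. perm ! i = n"
  proof -
    have "n \<in> set perm" using n(2) by (auto simp: perm_def)
    moreover have "length perm = 7" by (simp add: perm_def)
    ultimately show ?thesis by (auto simp: in_set_conv_nth)
  qed
  ultimately show ?thesis using n(1) by blast
qed

text \<open>The preimage of \<open>A\<close> consists of translates of the parts of \<open>A\<close>
  in the gaps of the image partition, and these gaps tile the interval.\<close>

lemma invariant_lborel_exch:
  assumes t: "- tmax < t" "t < tmax"
  shows "invariant_measure (exch t) (restrict_space lborel \<I>)"
proof -
  let ?L = "restrict_space lborel \<I>"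
  have meas: "exch t \<in> ?L \<rightarrow>\<^sub>M ?L"
  proof (rule measurable_restrict_space2)
    show "exch t \<in> space ?L \<rightarrow> \<I>" using exch_in[OF t] by (simp add: space_restrict_space)
    show "exch t \<in> ?L \<rightarrow>\<^sub>M lborel"
      using measurable_restrict_space1[OF borel_measurable_exch[OF t], of \<I>] by (simp add: measurable_def space_restrict_space sets_restrict_space)
  qed
  have "distr ?L ?L (exch t) = ?L"
  proof (rule measure_eqI)
    fix A assume "A \<in> sets (distr ?L ?L (exch t))"
    then have AL: "A \<in> sets ?L" and A: "A \<in> sets borel" "A \<subseteq> \<I>" by (auto simp: sets_restrict_space_iff)
    define Q where "Q i = {image_cuts t ! (perm ! i)..<image_cuts t ! Suc (perm ! i)}" for i
    define B where "B i = (+) (shifts ! i) -` (A \<inter> Q i)" for i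
    have B_iff: "x \<in> B i \<longleftrightarrow> cuts t ! i \<le> x \<and> x < cuts t ! Suc i \<and> x + shifts ! i \<in> A" if "i < 7" for i x
      using image_cuts_perm[OF that, of t] by (auto simp: B_def Q_def add.commute)
    have Q_sets: "A \<inter> Q i \<in> sets borel" for i using A by (simp add: Q_def)
    have B_sets: "B i \<in> sets borel" for i
      unfolding B_def by (rule measurable_sets_borel[OF _ Q_sets]) simp
    have "emeasure (distr ?L ?L (exch t)) A = emeasure ?L (exch t -` A \<inter> \<I>)"
      using meas AL by (simp add: emeasure_distr space_restrict_space)
    also have "\<dots> = emeasure lborel (exch t -` A \<inter> \<I>)"
      by (rule emeasure_restrict_space) auto
    also have "exch t -` A \<inter> \<I> = (\<Union>i<7. B i)"
    proof (intro set_eqI iffI)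
      fix x assume x: "x \<in> exch t -` A \<inter> \<I>"
      then have i: "piece t x < 7" "visits t (piece t x) x" using visits_piece by auto
      then have "x \<in> B (piece t x)"
        using B_iff[OF i(1), of x] x by (auto simp: visits_def exch_def)
      then show "x \<in> (\<Union>i<7. B i)" using visits_piece(1)[of x t] x by blast
    next
      fix x assume "x \<in> (\<Union>i<7. B i)"
      then obtain i where i: "i < 7" "x \<in> B i" by blast
      then show "x \<in> exch t -` A \<inter> \<I>"
        using B_iff[OF i(1), of x] exch_eqI[OF t i(1), of x] cuts_bounds(1)[OF t, of i] cuts_bounds(2)[OF t, of "Suc i"]
        by auto
    qed
    also have "emeasure lborel (\<Union>i<7. B i) = (\<Sum>i<7. emeasure lborel (B i))"
    proof (rule sum_emeasure[symmetric])
      show "disjoint_family_on B {..<7}"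
        unfolding disjoint_family_on_def using B_iff piece_eqI[OF t] by (metis (no_types, lifting) disjoint_iff lessThan_iff)
    qed (use B_sets in auto)
    also have "\<dots> = (\<Sum>i<7. emeasure lborel (A \<inter> Q i))"
    proof (intro sum.cong refl)
      fix i
      have "emeasure lborel (A \<inter> Q i) = emeasure (distr lborel borel ((+) (shifts ! i))) (A \<inter> Q i)"
        by (simp only: lborel_distr_plus)
      also have "\<dots> = emeasure lborel (B i)"
        using Q_sets by (simp add: emeasure_distr B_def)
      finally show "emeasure lborel (B i) = emeasure lborel (A \<inter> Q i)" by simp
    qed
    also have "\<dots> = emeasure lborel (\<Union>i<7. A \<inter> Q i)"
    proof (rule sum_emeasure)
      have "i = j" if "i < 7" "j < 7" "x \<in> Q i" "x \<in> Q j" for i j x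
      proof -
        have "\<not> perm ! i < perm ! j" if "i < 7" "j < 7" "x \<in> Q i" "x \<in> Q j" for i j
          using that image_cuts_mono[OF t, of "Suc (perm ! i)" "perm ! j"] perm_less_7[of j]
          unfolding Q_def by force
        then show ?thesis using that perm_inj by (metis linorder_neqE_nat)
      qed
      then show "disjoint_family_on (\<lambda>i. A \<inter> Q i) {..<7}" by (fastforce simp: disjoint_family_on_def)
    qed (use Q_sets in auto)
    also have "(\<Union>i<7. A \<inter> Q i) = A"
      using image_cuts_cover[of _ t] A(2) by (fastforce simp: Q_def)
    also have "emeasure lborel A = emeasure ?L A"
      using A by (intro emeasure_restrict_space[symmetric]) auto
    finally show "emeasure (distr ?L ?L (exch t)) A = emeasure ?L A" .
  qed simp
  with meas show ?thesis by (simp add: invariant_measure_def)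
qed

text \<open>A left eigenvector, with eigenvalue \<open>1/\<beta>\<close>, of the incidence matrix of \<open>returns\<close>.\<close>

definition roof :: "real list" where
  "roof = [1, 1 + \<alpha> + \<beta>, 1 + \<alpha> + \<beta>, 1 + \<alpha> + \<beta>, 1 + \<alpha>, 1 + \<alpha>, 1]"

text \<open>A finitely checkable counterpart of \<open>reaches\<close>: positivity of an entry of
  the \<open>n\<close>-th power of the incidence matrix of \<open>returns\<close>.\<close>

primrec linked :: "nat \<Rightarrow> nat \<Rightarrow> nat \<Rightarrow> bool" where
  "linked 0 i j \<longleftrightarrow> j = i"
| "linked (Suc n) i j \<longleftrightarrow> (\<exists>l\<in>set (returns ! j). linked n i l)"

text \<open>Primitivity of the incidence matrix, by 49 finite checks.\<close>

lemma linked_3: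
  assumes "i < 7" "j < 7"
  shows "linked 3 i j"
  using assms(1)
  by (rule_tac less_7_cases[OF assms(2)]; elim less_7_cases) (simp_all add: returns_def numeral_3_eq_3)

lemma reaches_if_linked:
  assumes "linked n i (piece 0 x)" "x \<in> \<I>"
  shows "reaches (exch 0) rescale (return_time 0) (piece 0) n i x"
  using assms
proof (induction n arbitrary: x)
  case (Suc n)
  then obtain l where l: "l \<in> set (returns ! piece 0 x)" "linked n i l" by auto
  then obtain k where k: "k < return_time 0 x" "returns ! piece 0 x ! k = l"
    by (auto simp: in_set_conv_nth return_time_def)
  have "piece 0 ((exch 0 ^^ k) (rescale x)) = l"
    using return_orbit(2)[of 0, OF _ _ Suc.prems(2), of k] k tmax_bounds by simp
  moreover have "rescale x \<in> \<I>" using rescale_in return_interval_subset Suc.prems(2) by blast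
  then have "(exch 0 ^^ k) (rescale x) \<in> \<I>"
    using funpow_in[of \<I> "exch 0"] exch_in[of 0] tmax_bounds by force
  ultimately show ?case using Suc.IH l k by auto
qed simp

lemma uniquely_ergodic_exch: "uniquely_ergodic_on \<I> (exch 0)"
proof -
  have t0: "- tmax < 0" "0 < tmax" "0 \<le> (0::real)" using tmax_bounds by auto
  \<comment> \<open>\<open>2\<close> bounds \<open>roof\<close>, \<open>5\<close> is the hitting
    time of \<open>hits_return_interval\<close>, \<open>3\<close> the exponent in
    \<open>linked_3\<close> and \<open>4\<close> the longest return.\<close>
  interpret self_induced "exch 0" rescale "return_time 0" "piece 0" \<beta> 2 "\<lambda>x. roof ! piece 0 x" 5 3 4 \<I>
  proof
    note orbit = return_orbit[OF t0(3,2), unfolded mult_zero_right]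
    fix x :: real assume x: "x \<in> \<I>"
    note i = visits_piece(1)[OF x, of 0]
    show "exch 0 x \<in> \<I>" by (rule exch_in[OF t0(1,2) x])
    show "rescale x \<in> \<I>" using rescale_in return_interval_subset x by blast
    show "0 < return_time 0 x" "return_time 0 x \<le> 4"
      using returns_bounds[OF i] by (auto simp: return_time_def)
    show "(exch 0 ^^ return_time 0 x) (rescale x) = rescale (exch 0 x)"
      by (rule first_return_exch(3)[OF x])
    show "\<exists>k\<le>5. \<exists>y\<in>\<I>. (exch 0 ^^ k) x = rescale y"
      using hits_return_interval[OF t0(3,2) x] rescale_surj by metis
    show "1 \<le> roof ! piece 0 x" "roof ! piece 0 x \<le> 2"
      using i tri_bounds by (elim less_7_cases; simp add: roof_def)+
    have "birkhoff_sum (exch 0) (\<lambda>x. roof ! piece 0 x) (return_time 0 x) (rescale x)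
        = (\<Sum>k<length (returns ! piece 0 x). roof ! (returns ! piece 0 x ! k))"
      unfolding birkhoff_sum_def
      by (intro sum.cong) (use orbit(2)[OF x] in \<open>auto simp: return_time_def\<close>)
    also have "\<dots> = sum_list (map ((!) roof) (returns ! piece 0 x))"
      by (simp add: sum_list_sum_nth atLeast0LessThan)
    also have "\<dots> = roof ! piece 0 x / \<beta>"
    proof -
      have "\<beta> * sum_list (map ((!) roof) (returns ! i)) = roof ! i" if "i < 7" for i
        using that by (elim less_7_cases; simp add: roof_def returns_def algebra_simps tri_mult_simps)
      from this[OF i] show ?thesis using tri_pos by (simp add: field_simps)
    qed
    finally show "birkhoff_sum (exch 0) (\<lambda>x. roof ! piece 0 x) (return_time 0 x) (rescale x) = roof ! piece 0 x / \<beta>" .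
    fix y :: real assume y: "y \<in> \<I>"
    show "reaches (exch 0) rescale (return_time 0) (piece 0) 3 (piece 0 y) x"
      by (rule reaches_if_linked[OF linked_3[OF visits_piece(1)[OF y] i] x])
    assume eq: "piece 0 x = piece 0 y"
    then show time: "return_time 0 x = return_time 0 y" by (simp add: return_time_def)
    fix k assume k: "k < return_time 0 x"
    then show "piece 0 ((exch 0 ^^ k) (rescale x)) = piece 0 ((exch 0 ^^ k) (rescale y))"
      using orbit(2)[OF x, of k] orbit(2)[OF y, of k] time eq by simp
    show "\<bar>(exch 0 ^^ k) (rescale x) - (exch 0 ^^ k) (rescale y)\<bar> = \<beta> * \<bar>x - y\<bar>"
      using orbit(1)[OF x, of k] orbit(1)[OF y, of k] k time eq tri_pos
      by (simp add: rescale_def abs_mult flip: right_diff_distrib)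
  qed (use tri_pos in auto)
  show ?thesis by (rule uniquely_ergodic[OF invariant_lborel_exch[OF t0(1,2)]])
qed

section \<open>Identification with the interval exchange of a length vector\<close>

text \<open>The type \<open>7\<close> has the numeral form \<open>bit1\<close>; its integer
  representatives 0 to 6 respect its order.\<close>

definition position :: "7 \<Rightarrow> nat" where "position i = nat (Rep_bit1 i)"

lemma position_less_7: "position i < 7"
  using bit1.Rep_less_n[of i] by (simp add: position_def)

lemma Rep_nonneg: "0 \<le> Rep_bit1 i"
  using Rep_bit1[of i] by simp

lemma position_less_iff: "position i < position j \<longleftrightarrow> i < j" and position_le_iff: "position i \<le> position j \<longleftrightarrow> i \<le> j"
  using Rep_nonneg[of i] Rep_nonneg[of j] by (auto simp: position_def less_bit1_def less_eq_bit1_def)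

lemma position_inj: "position i = position j \<longleftrightarrow> i = j"
  using position_le_iff by (metis order_antisym order_refl)

lemma position_of_nat: "k < 7 \<Longrightarrow> position (of_nat k) = k"
  unfolding position_def bit1.of_nat_eq bit1.Rep_Abs_mod by simp

lemma cuts_ends: "cuts t ! 0 = 0" "cuts t ! 7 = 1"
  by (simp_all add: cuts_def)

definition lengths :: "real \<Rightarrow> real ^ 7" where
  "lengths t = (\<chi> i. cuts t ! Suc (position i) - cuts t ! position i)"

definition exch_perm :: "7 \<Rightarrow> 7" where "exch_perm i = of_nat (perm ! position i)"

lemma position_exch_perm: "position (exch_perm i) = perm ! position i"
  by (simp add: exch_perm_def position_of_nat perm_less_7 position_less_7)

lemma exch_perm_permutes: "exch_perm permutes UNIV"
proof (rule bij_imp_permutes)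
  have "inj exch_perm"
    by (rule injI) (metis position_exch_perm position_inj perm_inj position_less_7)
  then show "bij_betw exch_perm UNIV UNIV"
    by (simp add: bij_betw_def finite_UNIV_inj_surj)
qed simp

text \<open>Moves sums over the type \<open>7\<close> to natural indices, where they
  telescope.\<close>

lemma sum_lengths_pos:
  assumes "S \<subseteq> {..<7}"
  shows "(\<Sum>j | position j \<in> S. lengths t $ j) = (\<Sum>k\<in>S. cuts t ! Suc k - cuts t ! k)"
proof (rule sum.reindex_bij_witness[where i = of_nat and j = position])
  show "of_nat (position a) = a" for a :: 7
    using position_of_nat[OF position_less_7[of a]] position_inj by metis
qed (use assms position_of_nat in \<open>auto simp: lengths_def\<close>)

lemma sum_lengths_less: "(\<Sum>j | j < i. lengths t $ j) = cuts t ! position i"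
  and sum_lengths_le: "(\<Sum>j | j \<le> i. lengths t $ j) = cuts t ! Suc (position i)"
proof -
  have *: "(\<Sum>j | position j \<in> {..<n}. lengths t $ j) = cuts t ! n" if "n \<le> 7" for n
    using sum_lengths_pos[of "{..<n}" t] that by (simp add: sum_lessThan_telescope cuts_ends)
  show "(\<Sum>j | j < i. lengths t $ j) = cuts t ! position i"
    using *[of "position i"] position_less_7[of i] by (simp add: position_less_iff)
  show "(\<Sum>j | j \<le> i. lengths t $ j) = cuts t ! Suc (position i)"
    using *[of "Suc (position i)"] position_less_7[of i] by (simp add: less_Suc_eq_le position_le_iff)
qed

lemma sum_lengths_UNIV: "(\<Sum>j\<in>UNIV. lengths t $ j) = 1"
  using sum_lengths_pos[of "{..<7}" t] position_less_7 by (simp add: sum_lessThan_telescope cuts_ends)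

lemma image_cuts_0: "image_cuts t ! 0 = 0"
  by (simp add: image_cuts_def)

text \<open>Reindexed by the position after the exchange, the lengths are the gaps of the image
  partition, and the sum telescopes.\<close>

lemma sum_lengths_perm: "(\<Sum>j | exch_perm j < exch_perm i. lengths t $ j) = image_cuts t ! (perm ! position i)"
proof -
  define n where "n = perm ! position i"
  have n: "n < 7" by (simp add: n_def perm_less_7 position_less_7)
  have inj: "inj_on ((!) perm) {..<7}" using perm_inj by (auto intro: inj_onI)
  have onto: "(!) perm ` {..<7} = {..<7}"
    using inj perm_less_7 by (intro endo_inj_surj) auto
  have "\<exists>k<7. r = perm ! k" if "r < n" for r
  proof -
    have "r \<in> (!) perm ` {..<7}" using that n unfolding onto by simp
    then show ?thesis by blast
  qed
  then have im: "(!) perm ` {k. k < 7 \<and> perm ! k < n} = {..<n}"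
    by auto
  have "(\<Sum>j | exch_perm j < exch_perm i. lengths t $ j) = (\<Sum>j | position j \<in> {k. k < 7 \<and> perm ! k < n}. lengths t $ j)"
    by (simp add: position_less_iff[symmetric] position_exch_perm position_less_7 n_def)
  also have "\<dots> = (\<Sum>k | k < 7 \<and> perm ! k < n. cuts t ! Suc k - cuts t ! k)"
    by (rule sum_lengths_pos) auto
  also have "\<dots> = (\<Sum>k | k < 7 \<and> perm ! k < n. image_cuts t ! Suc (perm ! k) - image_cuts t ! (perm ! k))"
    by (rule sum.cong) (auto simp: image_cuts_perm)
  also have "\<dots> = (\<Sum>r<n. image_cuts t ! Suc r - image_cuts t ! r)"
    unfolding im[symmetric]
    by (subst sum.reindex) (auto intro: inj_on_subset[OF inj])
  also have "\<dots> = image_cuts t ! n"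
    by (simp add: sum_lessThan_telescope image_cuts_0)
  finally show ?thesis by (simp add: n_def)
qed

lemma ie_domain_lengths: "ie_domain (lengths t) = {0..<1}"
  by (simp add: ie_domain_def sum_lengths_UNIV)

lemma ie_subinterval_lengths: "ie_subinterval (lengths t) i = {cuts t ! position i..<cuts t ! Suc (position i)}"
  by (simp add: ie_subinterval_def sum_lengths_less sum_lengths_le)

lemma interval_exchange_lengths:
  assumes t: "- tmax < t" "t < tmax"
  shows "interval_exchange exch_perm (lengths t) = exch t"
proof
  fix x
  show "interval_exchange exch_perm (lengths t) x = exch t x"
  proof (cases "x \<in> {0..<1}")
    case True
    then have p: "piece t x < 7" "cuts t ! piece t x \<le> x" "x < cuts t ! Suc (piece t x)"
      using piece_cases[of x t] by auto
    have "(THE i. x \<in> ie_subinterval (lengths t) i) = of_nat (piece t x)"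
    proof (rule the_equality)
      show "x \<in> ie_subinterval (lengths t) (of_nat (piece t x))"
        using p by (simp add: ie_subinterval_lengths position_of_nat)
      fix i assume "x \<in> ie_subinterval (lengths t) i"
      then have "piece t x = position i"
        using piece_eqI[OF t position_less_7[of i], of x] by (simp add: ie_subinterval_lengths)
      then show "i = of_nat (piece t x)" using p(1) position_of_nat position_inj by metis
    qed
    then show ?thesis
      using True p image_cuts_perm(1)[OF p(1), of t]
      unfolding interval_exchange_def exch_def ie_domain_lengths Let_def sum_lengths_less sum_lengths_perm
      by (simp add: position_of_nat)
  qed (auto simp: interval_exchange_def exch_def ie_domain_lengths)
qed

text \<open>All cuts are affine in the parameter, so the length vectors trace a straight
  line.\<close>

lemma lengths_convex: "(1 - w) *\<^sub>R lengths s + w *\<^sub>R lengths t = lengths ((1 - w) * s + w * t)"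
proof -
  have "(1 - w) * (cuts s ! Suc i - cuts s ! i) + w * (cuts t ! Suc i - cuts t ! i)
      = cuts ((1 - w) * s + w * t) ! Suc i - cuts ((1 - w) * s + w * t) ! i" if "i < 7" for i
    using that by (elim less_7_cases; simp add: cuts_def field_simps)
  then show ?thesis by (simp add: vec_eq_iff lengths_def position_less_7)
qed

lemma lengths_inj: "lengths s = lengths t \<longleftrightarrow> s = t"
proof
  assume "lengths s = lengths t"
  \<comment> \<open>The first length, \<open>(1 - \<alpha> - \<beta>) / 2 - t\<close>, already
    determines \<open>t\<close>.\<close>
  then have "lengths s $ of_nat 0 = lengths t $ of_nat 0" by simp
  then show "s = t" by (simp add: lengths_def position_of_nat[of 0, simplified] cuts_def)
qed simp

lemma lengths_positive:
  assumes "- tmax < t" "t < tmax"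
  shows "lengths t \<in> positive_vectors"
  using cuts_less_Suc[OF assms position_less_7] by (simp add: positive_vectors_def lengths_def)

theorem corollary1p6:
  shows "\<exists>(\<sigma> :: 7 \<Rightarrow> 7) (IE0 :: real \<Rightarrow> real) (a0 :: real ^ 7) (u :: real ^ 7) (v :: real ^ 7).
    \<sigma> permutes UNIV \<and>
    u \<noteq> v \<and>
    closed_segment u v \<subseteq> positive_vectors \<and>
    a0 \<in> open_segment u v \<and>
    IE0 = interval_exchange \<sigma> a0 \<and>
    uniquely_ergodic_on (ie_domain a0) IE0 \<and>
    self_similar_on (ie_domain a0) IE0 \<and>
    (\<forall>a \<in> closed_segment u v - {a0}.
       periodic_on (ie_domain a) (interval_exchange \<sigma> a))"
proof -
  \<comment> \<open>The end points are symmetric, so that \<open>lengths 0\<close> is the midpoint,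
    and \<open>1 / 20 < tmax\<close> keeps the whole segment in the admissible range.\<close>
  let ?u = "lengths (- 1 / 20)" and ?v = "lengths (1 / 20)"
  have segment: "\<exists>t. a = lengths t \<and> - tmax < t \<and> t < tmax" if a: "a \<in> closed_segment ?u ?v" for a
  proof -
    obtain w where w: "0 \<le> w" "w \<le> 1" "a = (1 - w) *\<^sub>R ?u + w *\<^sub>R ?v"
      using a unfolding in_segment(1) by blast
    then have "a = lengths ((1 - w) * (- 1 / 20) + w * (1 / 20))" by (simp only: lengths_convex)
    moreover have "- tmax < (1 - w) * (- 1 / 20) + w * (1 / 20)" "(1 - w) * (- 1 / 20) + w * (1 / 20) < tmax"
      using w(1,2) tmax_bounds(1) by (simp_all add: field_simps)
    ultimately show ?thesis by blast
  qed
  have pos: "closed_segment ?u ?v \<subseteq> positive_vectors"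
    using segment lengths_positive by blast
  have ne: "?u \<noteq> ?v" by (simp add: lengths_inj)
  have "lengths 0 = (1 - 1 / 2) *\<^sub>R ?u + (1 / 2) *\<^sub>R ?v"
    unfolding lengths_convex by simp
  then have mid: "lengths 0 \<in> open_segment ?u ?v"
    using ne unfolding in_segment(2) by (intro conjI exI[of _ "1 / 2"]) simp_all
  have ie0: "interval_exchange exch_perm (lengths 0) = exch 0"
    by (rule interval_exchange_lengths) (use tmax_bounds in auto)
  have per: "periodic_on (ie_domain a) (interval_exchange exch_perm a)"
    if a: "a \<in> closed_segment ?u ?v - {lengths 0}" for a
  proof -
    obtain t where t: "a = lengths t" "- tmax < t" "t < tmax" using segment a by blast
    moreover have "t \<noteq> 0" using a t(1) by auto
    ultimately show ?thesis
      using periodic_exch by (simp add: ie_domain_lengths interval_exchange_lengths)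
  qed
  have ue: "uniquely_ergodic_on (ie_domain (lengths 0)) (exch 0)"
    and ss: "self_similar_on (ie_domain (lengths 0)) (exch 0)"
    using uniquely_ergodic_exch self_similar_exch by (simp_all only: ie_domain_lengths)
  show ?thesis
    by (rule exI[of _ exch_perm], rule exI[of _ "exch 0"], rule exI[of _ "lengths 0"], rule exI[of _ ?u],
        rule exI[of _ ?v]) (intro conjI ballI exch_perm_permutes ne pos mid ie0[symmetric] ue ss per)
qed

end
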